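(* Let $n\ge2$ and let $\lambda=(\lambda_1>\lambda_2>\ldots>\lambda_{n-1}>\lambda_n=0)$ be a partition corresponding to a regular weight of type $A_{n-1}$. Given any nonattacking filling $\sigma\in\mathcal{T}(\lambda,n)$, we have $f^{-1}(\sigma)\neq\emptyset$, and $x^{w(\mu(T))}=x^{\mathrm{content}(\sigma)}$ for all $(w,T)\in f^{-1}(\sigma)$. Furthermore, $$\sum_{(w,T)\in f^{-1}(\sigma)} t^{\frac12(\ell(w)-\ell(wT)-|T|)}(1-t)^{|T|}\left(\prod_{j,\,(i,k)\in T_j^+}\frac{1}{1-q^{\mathrm{arm}(i,j-1)}t^{k-i}}\right)\left(\prod_{j,\,(i,k)\in T_j^-}\frac{q^{\mathrm{arm}(i,j-1)}t^{k-i}}{1-q^{\mathrm{arm}(i,j-1)}t^{k-i}}\right)$$ $$= t^{n(\lambda)-\mathrm{inv}(\sigma)}\,q^{\mathrm{maj}(\sigma)}\left(\prod_{u\in\mathrm{Diff}(\sigma)}\frac{1-t}{1-q^{\mathrm{arm}(u)}t^{\mathrm{leg}(u)+1}}\right).$$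
   Context: Diagrams and fillings. For a partition $\lambda$ put $n(\lambda)=\sum_i(i-1)\lambda_i$; $\lambda'$ is the conjugate partition. Identify $\lambda$ with its Young diagram $\{(i,j)\in\mathbb{Z}_{>0}\times\mathbb{Z}_{>0}:j\le\lambda_i\}$ ($i$ = row, $j$ = column; drawn in the third quadrant, with rows numbered top to bottom and columns right to left). For a cell $u=(i,j)$, $\mathrm{arm}(u)$ is the number of cells $(i,j')\in\lambda$ with $j'>j$, and $\mathrm{leg}(u)$ is the number of cells $(i',j)\in\lambda$ with $i'>i$. Two cells attack each other if they are either $(i,j),(k,j)$ with $i\ne k$, or $(i,j),(k,j-1)$ with $i<k$. A filling is a function $\sigma:\lambda\to[n]$; it is nonattacking if $\sigma(u)\neq\sigma(v)$ whenever $u,v$ attack each other; $\mathcal{T}(\lambda,n)$ is the set of nonattacking fillings. $\mathrm{content}(\sigma)=(c_1,\ldots,c_n)$ with $c_i=|\sigma^{-1}(i)|$. $\mathrm{Des}(\sigma)=\{(i,j)\in\lambda:(i,j+1)\in\lambda,\ \sigma(i,j)>\sigma(i,j+1)\}$, $\mathrm{Diff}(\sigma)=\{(i,j)\in\lambda:(i,j+1)\in\lambda,\ \sigma(i,j)\ne\sigma(i,j+1)\}$. Reading order: each column from top to bottom (increasing $i$), columns from right to left (increasing $j$). $\mathrm{Inv}(\sigma)$ is the set of pairs of cells $(u,v)$ that attack each other, with $u$ preceding $v$ in reading order and $\sigma(u)>\sigma(v)$. $\mathrm{maj}(\sigma)=\sum_{u\in\mathrm{Des}(\sigma)}\mathrm{arm}(u)$,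 $\mathrm{inv}(\sigma)=|\mathrm{Inv}(\sigma)|-\sum_{u\in\mathrm{Des}(\sigma)}\mathrm{leg}(u)$. The chain of roots. $W=S_n$, with length function $\ell$ (number of inversions of a permutation), product $(uv)(i)=u(v(i))$. For $i<j$, $(i,j)$ denotes both the positive root $\alpha_{ij}=\varepsilon_i-\varepsilon_j$ and the transposition of $i$ and $j$; right multiplication of $w$ by $(i,j)$ swaps the entries of $w=w(1)\ldots w(n)$ in positions $i$ and $j$. For $1\le k\le n-1$ let $\Gamma(k)$ be the sequence $$(k,n),(k,n-1),\ldots,(k,k+1),\ (k-1,n),\ldots,(k-1,k+1),\ \ldots,\ (1,n),(1,n-1),\ldots,(1,k+1),$$ and let $\Gamma'(k)$ be obtained from $\Gamma(k)$ by removing the roots $(i,k+1)$, $i=k,\ldots,1$. Let $\Gamma=\Gamma_{\lambda_1}\Gamma_{\lambda_1-1}\ldots\Gamma_2$ (concatenation), where $\Gamma_j=\Gamma'(\lambda'_j)$ if $j=\min\{i:\lambda'_i=\lambda'_j\}$ and $\Gamma_j=\Gamma(\lambda'_j)$ otherwise. Write $\Gamma=(\beta_1,\ldots,\beta_m)$ and $l_i=|\{j\le i:\beta_j=\beta_i\}|$. Folding pairs. A folding pair is a pair $(w,J)$ with $w\in S_n$ and $J=\{j_1<\ldots<j_s\}\subseteq\{1,\ldots,m\}$ arbitrary; $J$ is identified with the subsequence $T$ of $\Gamma$ indexed by the positions in $J$, factored as $T=T_{\lambda_1}\ldots T_2$ according to $\Gamma=\Gamma_{\lambda_1}\ldots\Gamma_2$;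 $|T|=s$. The set of folding pairs is $\mathcal{F}(\lambda)$. With $r_i$ the reflection (transposition) in $\beta_i$, $wT=wr_{j_1}\cdots r_{j_s}$, and similarly $wT_{\lambda_1}\ldots T_j$ is $w$ right multiplied successively by the transpositions in $T_{\lambda_1},\ldots,T_j$, from left to right. The element of $T$ at position $j_i$ lies in $T^+$ (positive folding) if $wr_{j_1}\cdots r_{j_{i-1}}>wr_{j_1}\cdots r_{j_i}$ in Bruhat order (i.e. the length decreases), and in $T^-$ otherwise; this induces $T_j=T_j^+\sqcup T_j^-$. Weight. Let $\widehat r_i=s_{\beta_i,l_i}$ be the affine reflection $\nu\mapsto\nu-(\langle\nu,\beta_i^\vee\rangle-l_i)\beta_i$, where $\langle\nu,\alpha_{ab}^\vee\rangle=\nu_a-\nu_b$. Put $\mu(T)=\widehat r_{j_1}\cdots\widehat r_{j_s}(\lambda)$, with $\lambda=(\lambda_1,\ldots,\lambda_n)\in\mathbb{Z}^n$. $S_n$ acts linearly by $w(\varepsilon_i)=\varepsilon_{w(i)}$, and $x^\nu=x_1^{\nu_1}\cdots x_n^{\nu_n}$ for $\nu\in\mathbb{Z}^n$. Filling map. For $(w,T)\in\mathcal{F}(\lambda)$ and $1\le j\le\lambda_1$ put $\pi_j=wT_{\lambda_1}T_{\lambda_1-1}\ldots T_{j+1}$ (so $\pi_{\lambda_1}=w$). The filling map $f:\mathcal{F}(\lambda)\to\mathcal{T}(\lambda,n)$ is $f(w,T)=\sigma$ with $\sigma(i,j)=\pi_j(i)$ for each cell $(i,j)$ of $\lambda$.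 Here $q,t$ are indeterminates. *)

theory Defs
  imports
    "HOL-Computational_Algebra.Computational_Algebra"
    "HOL-Combinatorics.Combinatorics"
    "HOL-Library.FuncSet"
    "HOL-Library.Poly_Mapping"
begin

section \<open>Indeterminates\<close>

text \<open>The indeterminates \<open>q\<close>, \<open>t\<close> are the two generators of the rational function field
  \<open>Q(t)(q)\<close>, realised as the field of fractions of \<open>Q[t][q]\<close>.\<close>

type_synonym qt_field = "rat poly poly fract"

definition q_var :: qt_field where
  "q_var = Fract [:0, 1:] 1"

definition t_var :: qt_field where
  "t_var = Fract [:[:0, 1:]:] 1"

text \<open>The indeterminates \<open>x\<^sub>i\<close> live in the field of fractions of the polynomial ring
  \<open>Q[x\<^sub>0, x\<^sub>1, \<dots>]\<close>, so that arbitrary integer exponents make sense.\<close>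

type_synonym x_field = "((nat \<Rightarrow>\<^sub>0 nat) \<Rightarrow>\<^sub>0 rat) fract"

definition x_var :: "nat \<Rightarrow> x_field" where
  "x_var i = Fract (Poly_Mapping.single (Poly_Mapping.single i 1) 1) 1"

text \<open>Only the coordinates \<open>1, \<dots>, n\<close> of a weight \<open>\<nu>\<close> are meaningful.\<close>

definition x_monom :: "nat \<Rightarrow> (nat \<Rightarrow> int) \<Rightarrow> x_field" where
  "x_monom n \<nu> = (\<Prod>i\<in>{1..n}. x_var i powi \<nu> i)"


section \<open>Partitions, diagrams and fillings\<close>

text \<open>A partition is a function \<open>lam\<close> whose values \<open>lam 1 \<ge> lam 2 \<ge> \<dots>\<close> are its parts and
  are eventually zero; \<open>lam 0\<close> is never used. In a cell \<open>(i, j)\<close>, \<open>i\<close> is the row and \<open>j\<close> the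
  column.\<close>

definition regular_partition :: "nat \<Rightarrow> (nat \<Rightarrow> nat) \<Rightarrow> bool" where
  "regular_partition n lam \<longleftrightarrow> (\<forall>i\<in>{1..<n}. lam (Suc i) < lam i) \<and> (\<forall>i\<ge>n. lam i = 0)"

definition diagram :: "(nat \<Rightarrow> nat) \<Rightarrow> (nat \<times> nat) set" where
  "diagram lam = {(i, j). 1 \<le> i \<and> 1 \<le> j \<and> j \<le> lam i}"

definition conjugate :: "(nat \<Rightarrow> nat) \<Rightarrow> nat \<Rightarrow> nat" where
  "conjugate lam j = card {i. 1 \<le> i \<and> j \<le> lam i}"

definition n_stat :: "(nat \<Rightarrow> nat) \<Rightarrow> nat" where
  "n_stat lam = (\<Sum>i | 1 \<le> i \<and> 0 < lam i. (i - 1) * lam i)"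

definition arm :: "(nat \<Rightarrow> nat) \<Rightarrow> nat \<times> nat \<Rightarrow> nat" where
  "arm lam = (\<lambda>(i, j). card {j'. (i, j') \<in> diagram lam \<and> j < j'})"

definition leg :: "(nat \<Rightarrow> nat) \<Rightarrow> nat \<times> nat \<Rightarrow> nat" where
  "leg lam = (\<lambda>(i, j). card {i'. (i', j) \<in> diagram lam \<and> i < i'})"

text \<open>Attacking is a symmetric relation on cells; the second alternative of the definition (cells
  in consecutive columns) is therefore written in both orders. With positive column indices,
  \<open>l + 1 = j\<close> says that the second cell is in column \<open>j - 1\<close>.\<close>

definition attacks :: "nat \<times> nat \<Rightarrow> nat \<times> nat \<Rightarrow> bool" where
  "attacks = (\<lambda>(i, j) (k, l).
     (l = j \<and> i \<noteq> k) \<or> (l + 1 = j \<and> i < k) \<or> (j + 1 = l \<and> k < i))"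

text \<open>Fillings take the value \<open>undefined\<close> outside the diagram, so that equality of fillings is
  equality of functions.\<close>

definition nonattacking_fillings :: "(nat \<Rightarrow> nat) \<Rightarrow> nat \<Rightarrow> (nat \<times> nat \<Rightarrow> nat) set" where
  "nonattacking_fillings lam n =
     {\<sigma> \<in> diagram lam \<rightarrow>\<^sub>E {1..n}.
        \<forall>u\<in>diagram lam. \<forall>v\<in>diagram lam. attacks u v \<longrightarrow> \<sigma> u \<noteq> \<sigma> v}"

definition fill_content :: "(nat \<Rightarrow> nat) \<Rightarrow> (nat \<times> nat \<Rightarrow> nat) \<Rightarrow> nat \<Rightarrow> int" where
  "fill_content lam \<sigma> c = int (card {u \<in> diagram lam. \<sigma> u = c})"

definition Des :: "(nat \<Rightarrow> nat) \<Rightarrow> (nat \<times> nat \<Rightarrow> nat) \<Rightarrow> (nat \<times> nat) set" where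
  "Des lam \<sigma> = {(i, j). (i, j) \<in> diagram lam \<and> (i, j + 1) \<in> diagram lam \<and> \<sigma> (i, j) > \<sigma> (i, j + 1)}"

definition Diff :: "(nat \<Rightarrow> nat) \<Rightarrow> (nat \<times> nat \<Rightarrow> nat) \<Rightarrow> (nat \<times> nat) set" where
  "Diff lam \<sigma> = {(i, j). (i, j) \<in> diagram lam \<and> (i, j + 1) \<in> diagram lam \<and> \<sigma> (i, j) \<noteq> \<sigma> (i, j + 1)}"

definition reads_before :: "nat \<times> nat \<Rightarrow> nat \<times> nat \<Rightarrow> bool" where
  "reads_before = (\<lambda>(i, j) (k, l). j < l \<or> (j = l \<and> i < k))"

definition Inv :: "(nat \<Rightarrow> nat) \<Rightarrow> (nat \<times> nat \<Rightarrow> nat) \<Rightarrow> ((nat \<times> nat) \<times> (nat \<times> nat)) set" where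
  "Inv lam \<sigma> = {(u, v). u \<in> diagram lam \<and> v \<in> diagram lam \<and> attacks u v \<and> reads_before u v \<and> \<sigma> u > \<sigma> v}"

definition maj_stat :: "(nat \<Rightarrow> nat) \<Rightarrow> (nat \<times> nat \<Rightarrow> nat) \<Rightarrow> nat" where
  "maj_stat lam \<sigma> = (\<Sum>u\<in>Des lam \<sigma>. arm lam u)"

definition inv_stat :: "(nat \<Rightarrow> nat) \<Rightarrow> (nat \<times> nat \<Rightarrow> nat) \<Rightarrow> int" where
  "inv_stat lam \<sigma> = int (card (Inv lam \<sigma>)) - (\<Sum>u\<in>Des lam \<sigma>. int (leg lam u))"


section \<open>The symmetric group\<close>

text \<open>Elements of \<open>S\<^sub>n\<close> are the functions that permute \<open>{1..n}\<close>, with product \<open>u \<circ> v\<close>.\<close>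

definition perm_length :: "nat \<Rightarrow> (nat \<Rightarrow> nat) \<Rightarrow> nat" where
  "perm_length n w = card {(i, j). 1 \<le> i \<and> i < j \<and> j \<le> n \<and> w i > w j}"

text \<open>Strict Bruhat order: the transitive closure of the relation that right multiplication by a
  reflection increases the length.\<close>

definition bruhat_less :: "nat \<Rightarrow> (nat \<Rightarrow> nat) \<Rightarrow> (nat \<Rightarrow> nat) \<Rightarrow> bool" where
  "bruhat_less n =
     (\<lambda>u v. \<exists>a b. 1 \<le> a \<and> a < b \<and> b \<le> n \<and> v = u \<circ> transpose a b \<and>
                 perm_length n u < perm_length n v)\<^sup>+\<^sup>+"

text \<open>The linear action with \<open>w(\<epsilon>\<^sub>i) = \<epsilon>\<^sub>w\<^sub>(\<^sub>i\<^sub>)\<close> moves the coordinate \<open>i\<close> to \<open>w i\<close>.\<close>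

definition perm_act :: "(nat \<Rightarrow> nat) \<Rightarrow> (nat \<Rightarrow> int) \<Rightarrow> nat \<Rightarrow> int" where
  "perm_act w \<nu> i = \<nu> (inv w i)"


section \<open>The chain of roots\<close>

definition Gamma_full :: "nat \<Rightarrow> nat \<Rightarrow> (nat \<times> nat) list" where
  "Gamma_full n k = concat (map (\<lambda>i. map (\<lambda>c. (i, c)) (rev [k+1..<n+1])) (rev [1..<k+1]))"

definition Gamma_reduced :: "nat \<Rightarrow> nat \<Rightarrow> (nat \<times> nat) list" where
  "Gamma_reduced n k = filter (\<lambda>(i, c). c \<noteq> k + 1) (Gamma_full n k)"

definition Gamma_factor :: "nat \<Rightarrow> (nat \<Rightarrow> nat) \<Rightarrow> nat \<Rightarrow> (nat \<times> nat) list" where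
  "Gamma_factor n lam j =
     (if j = (LEAST i. 1 \<le> i \<and> conjugate lam i = conjugate lam j)
      then Gamma_reduced n (conjugate lam j) else Gamma_full n (conjugate lam j))"

text \<open>The chain \<open>\<Gamma> = \<Gamma>\<^bsub>lam 1\<^esub> \<dots> \<Gamma>\<^sub>2\<close>, where each root is paired with the index \<open>j\<close> of the factor
  \<open>\<Gamma>\<^sub>j\<close> it belongs to: an entry \<open>(j, i, k)\<close> stands for the root \<open>(i, k)\<close> in \<open>\<Gamma>\<^sub>j\<close>. As the roots
  within one factor are distinct, the entries of this list are distinct. Positions in the chain
  are counted from 0.\<close>

definition Gamma_chain :: "nat \<Rightarrow> (nat \<Rightarrow> nat) \<Rightarrow> (nat \<times> nat \<times> nat) list" where
  "Gamma_chain n lam =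
     concat (map (\<lambda>j. map (\<lambda>\<beta>. (j, \<beta>)) (Gamma_factor n lam j)) (rev [2..<lam 1 + 1]))"

definition chain_factor :: "nat \<Rightarrow> (nat \<Rightarrow> nat) \<Rightarrow> nat \<Rightarrow> nat" where
  "chain_factor n lam p = fst (Gamma_chain n lam ! p)"

definition chain_root :: "nat \<Rightarrow> (nat \<Rightarrow> nat) \<Rightarrow> nat \<Rightarrow> nat \<times> nat" where
  "chain_root n lam p = snd (Gamma_chain n lam ! p)"

definition chain_level :: "nat \<Rightarrow> (nat \<Rightarrow> nat) \<Rightarrow> nat \<Rightarrow> nat" where
  "chain_level n lam p = card {p'. p' \<le> p \<and> chain_root n lam p' = chain_root n lam p}"


section \<open>Folding pairs\<close>

definition folding_pairs :: "nat \<Rightarrow> (nat \<Rightarrow> nat) \<Rightarrow> ((nat \<Rightarrow> nat) \<times> nat set) set" where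
  "folding_pairs n lam = {w. w permutes {1..n}} \<times> Pow {..<length (Gamma_chain n lam)}"

definition root_transposition :: "nat \<times> nat \<Rightarrow> nat \<Rightarrow> nat" where
  "root_transposition = (\<lambda>(a, b). transpose a b)"

text \<open>\<open>w\<close> right multiplied successively by the reflections at the positions in \<open>P\<close>, in increasing
  order of positions.\<close>

definition fold_mult :: "nat \<Rightarrow> (nat \<Rightarrow> nat) \<Rightarrow> (nat \<Rightarrow> nat) \<Rightarrow> nat set \<Rightarrow> nat \<Rightarrow> nat" where
  "fold_mult n lam w P =
     fold (\<lambda>p u. u \<circ> root_transposition (chain_root n lam p)) (sorted_list_of_set P) w"

definition positive_folding :: "nat \<Rightarrow> (nat \<Rightarrow> nat) \<Rightarrow> (nat \<Rightarrow> nat) \<Rightarrow> nat set \<Rightarrow> nat \<Rightarrow> bool" where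
  "positive_folding n lam w J p \<longleftrightarrow>
     bruhat_less n (fold_mult n lam w {x \<in> J. x \<le> p}) (fold_mult n lam w {x \<in> J. x < p})"

text \<open>The sets of all \<open>(j, i, k)\<close> with \<open>(i, k)\<close> in \<open>T\<^sub>j\<^sup>+\<close> and in \<open>T\<^sub>j\<^sup>-\<close>, respectively.\<close>

definition T_plus :: "nat \<Rightarrow> (nat \<Rightarrow> nat) \<Rightarrow> (nat \<Rightarrow> nat) \<Rightarrow> nat set \<Rightarrow> (nat \<times> nat \<times> nat) set" where
  "T_plus n lam w J = {Gamma_chain n lam ! p | p. p \<in> J \<and> positive_folding n lam w J p}"

definition T_minus :: "nat \<Rightarrow> (nat \<Rightarrow> nat) \<Rightarrow> (nat \<Rightarrow> nat) \<Rightarrow> nat set \<Rightarrow> (nat \<times> nat \<times> nat) set" where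
  "T_minus n lam w J = {Gamma_chain n lam ! p | p. p \<in> J \<and> \<not> positive_folding n lam w J p}"

text \<open>The affine reflection \<open>\<nu> \<mapsto> \<nu> - (\<langle>\<nu>, \<alpha>\<^sup>\<or>\<rangle> - l) \<alpha>\<close> for \<open>\<alpha> = \<epsilon>\<^sub>a - \<epsilon>\<^sub>b\<close>.\<close>

definition affine_reflection :: "nat \<times> nat \<Rightarrow> int \<Rightarrow> (nat \<Rightarrow> int) \<Rightarrow> nat \<Rightarrow> int" where
  "affine_reflection = (\<lambda>(a, b) l \<nu> c.
     \<nu> c - (\<nu> a - \<nu> b - l) * (of_bool (c = a) - of_bool (c = b)))"

definition fold_weight :: "nat \<Rightarrow> (nat \<Rightarrow> nat) \<Rightarrow> nat set \<Rightarrow> nat \<Rightarrow> int" where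
  "fold_weight n lam J =
     foldr (\<lambda>p. affine_reflection (chain_root n lam p) (int (chain_level n lam p)))
       (sorted_list_of_set J) (\<lambda>i. int (lam i))"

text \<open>In the filling map, the permutation \<open>\<pi>\<^sub>j = w T\<^bsub>lam 1\<^esub> \<dots> T\<^bsub>j+1\<^esub>\<close> is obtained from the positions
  of \<open>J\<close> lying in the factors \<open>\<Gamma>\<^bsub>lam 1\<^esub>, \<dots>, \<Gamma>\<^bsub>j+1\<^esub>\<close>.\<close>

definition filling_map ::
    "nat \<Rightarrow> (nat \<Rightarrow> nat) \<Rightarrow> (nat \<Rightarrow> nat) \<times> nat set \<Rightarrow> nat \<times> nat \<Rightarrow> nat" where
  "filling_map n lam = (\<lambda>(w, J).
     restrict (\<lambda>(i, j). fold_mult n lam w {p \<in> J. j < chain_factor n lam p} i) (diagram lam))"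

definition filling_fibre ::
    "nat \<Rightarrow> (nat \<Rightarrow> nat) \<Rightarrow> (nat \<times> nat \<Rightarrow> nat) \<Rightarrow> ((nat \<Rightarrow> nat) \<times> nat set) set" where
  "filling_fibre n lam \<sigma> = {F \<in> folding_pairs n lam. filling_map n lam F = \<sigma>}"

text \<open>The exponent \<open>(\<ell>(w) - \<ell>(wT) - |T|) / 2\<close>. It is a possibly negative integer: each reflection
  changes the parity of the length, so the division by 2 is exact.\<close>

definition fold_exponent :: "nat \<Rightarrow> (nat \<Rightarrow> nat) \<Rightarrow> (nat \<Rightarrow> nat) \<Rightarrow> nat set \<Rightarrow> int" where
  "fold_exponent n lam w J =
     (int (perm_length n w) - int (perm_length n (fold_mult n lam w J)) - int (card J)) div 2"

end

theory Submission
  imports Defs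
begin

text \<open>The sum over the fibre factors over the cells of the diagram, and so does the right-hand side.

  Let \<open>u\<^sub>p\<close> be \<open>w\<close> multiplied by the reflections of \<open>T\<close> at positions before \<open>p\<close>. The exponent
  \<open>(\<ell>(w) - \<ell>(wT) - |T|) / 2\<close> telescopes, so the summand is a product over the positions \<open>p\<close> in \<open>J\<close>
  of a weight that depends only on the root at \<open>p\<close> and on \<open>u\<^bsub>p+1\<^esub>\<close>
  (\<open>folding_summand_eq_path_weight\<close>). This suggests reading the chain backwards, from \<open>wT\<close>: that
  permutation is known, as the first column of \<open>\<sigma>\<close> has \<open>n - 1\<close> entries.

  Write \<open>k = \<lambda>'\<^sub>j\<close> and \<open>K = \<lambda>'\<^bsub>j-1\<^esub>\<close>. As \<open>\<lambda>\<close> is regular, \<open>K\<close> is \<open>k\<close> or \<open>k + 1\<close>, and in both cases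
  \<open>\<Gamma>\<^sub>j\<close> read backwards consists of rows \<open>i = 1, \<dots>, k\<close>, the row \<open>i\<close> being
  \<open>(i, K+1), (i, K+2), \<dots>, (i, n)\<close>. The row \<open>i\<close> alone has to replace the entry \<open>\<sigma>(i, j-1)\<close> at
  position \<open>i\<close> by \<open>\<sigma>(i, j)\<close>. Since \<open>\<sigma>\<close> is nonattacking, the entry \<open>\<sigma>(i, j)\<close> is either there already,
  and then no root of the row is used, or at some position beyond \<open>K\<close>. In the second case the entry
  can be brought in directly or by passing through intermediate positions, and the total weight of all
  ways collapses: omitting or using the first root of the row gives two terms whose sum does not
  depend on the entry at that position (\<open>swap_factor_compose\<close>). What remains is the weight that a direct
  exchange would have at the position \<open>K + 1\<close> (\<open>fold_sum_row\<close>). It involves only the number of entries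
  of column \<open>j - 1\<close> below row \<open>i\<close> whose values lie between \<open>\<sigma>(i, j-1)\<close> and \<open>\<sigma>(i, j)\<close>, and hence only
  \<open>\<sigma>\<close>. So rows, columns and finally the whole chain multiply (\<open>fold_sum_column\<close>,
  \<open>guarded_sum_chain_prefix\<close>, \<open>sum_path_weight_fibre\<close>).

  The exponents of \<open>q\<close> agree cell by cell. For the exponents of \<open>t\<close>, each pair of cells in a column
  accounts for exactly one unit of \<open>n(\<lambda>)\<close>, either as an inversion or through the between-numbers
  (\<open>inversion_identity\<close>). The right-hand side is not zero, and so the fibre cannot be empty.

  For the monomial, the level of \<open>(i, c)\<close> in \<open>\<Gamma>\<^sub>j\<close> is \<open>\<lambda>\<^sub>i - (j - 1)\<close>, the number of cells of row \<open>i\<close> in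
  the columns from \<open>j\<close> on, while row \<open>c\<close> has no such cells. The affine reflection therefore keeps these
  cells in place and exchanges what the coordinates \<open>i\<close> and \<open>c\<close> have in excess of them, just as the
  transposition exchanges the entries (\<open>weight_matches_step\<close>).\<close>

section \<open>Monomials in the two indeterminates\<close>

lemma t_var_nonzero: "t_var \<noteq> 0"
  by (simp add: t_var_def eq_fract Zero_fract_def)

lemma q_var_nonzero: "q_var \<noteq> 0"
  by (simp add: q_var_def eq_fract Zero_fract_def)

lemma Fract_one_power: "Fract p 1 ^ k = Fract (p ^ k) 1"
  by (induction k) (auto simp: One_fract_def)

text \<open>Setting \<open>q = 1\<close> and then \<open>t = 0\<close> separates the two sides. Hence no denominator in the identity vanishes.\<close>

lemma qt_monomial_neq_1:
  assumes "0 < b"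
  shows "q_var ^ a * t_var ^ b \<noteq> 1"
proof
  assume "q_var ^ a * t_var ^ b = 1"
  then have "[:0, 1:] ^ a * [:[:0, 1:]:] ^ b = (1 :: rat poly poly)"
    by (simp add: q_var_def t_var_def Fract_one_power One_fract_def eq_fract)
  then have "poly (poly ([:0, 1:] ^ a * [:[:0, 1:]:] ^ b) 1) 0 = poly (poly (1 :: rat poly poly) 1) 0"
    by (rule arg_cong)
  then show False
    using assms by (simp add: zero_power)
qed

section \<open>Length and transpositions\<close>

definition between :: "nat \<Rightarrow> nat \<Rightarrow> nat \<Rightarrow> bool" where
  "between x y z \<longleftrightarrow> min x y < z \<and> z < max x y"

text \<open>Values \<open>x\<close> and \<open>y\<close> may come in either order, so that positive and negative foldings are counted alike.
  Only the positions strictly between \<open>i\<close> and \<open>c\<close> are inspected.\<close>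

definition num_between :: "(nat \<Rightarrow> nat) \<Rightarrow> nat \<Rightarrow> nat \<Rightarrow> nat \<Rightarrow> nat \<Rightarrow> nat" where
  "num_between u i c x y = card {p. i < p \<and> p < c \<and> between x y (u p)}"

lemma num_between_Suc:
  assumes "i < c"
  shows "num_between u i (Suc c) x y = num_between u i c x y + of_bool (between x y (u c))"
proof -
  have "{p. i < p \<and> p < Suc c \<and> between x y (u p)}
      = {p. i < p \<and> p < c \<and> between x y (u p)} \<union> (if between x y (u c) then {c} else {})"
    using assms by (auto simp: less_Suc_eq)
  then show ?thesis
    by (auto simp: num_between_def)
qed

lemma perm_length_eq_sum:
  "int (perm_length n w)
     = (\<Sum>(a, b)\<in>{1..n} \<times> {1..n}. of_bool (a < b) * of_bool (w a > w b))"
proof -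
  have "{(i, j). 1 \<le> i \<and> i < j \<and> j \<le> n \<and> w i > w j}
      = {z \<in> {1..n} \<times> {1..n}. fst z < snd z \<and> w (fst z) > w (snd z)}"
    by auto
  then have "int (perm_length n w)
      = (\<Sum>z\<in>{1..n} \<times> {1..n}. of_bool (fst z < snd z \<and> w (fst z) > w (snd z)))"
    unfolding perm_length_def by (simp add: Int_def)
  then show ?thesis
    by (simp add: case_prod_beta of_bool_conj)
qed

lemma sum_square_fix_fst:
  fixes h :: "nat \<Rightarrow> int"
  assumes "d \<in> A" "finite A"
  shows "(\<Sum>(a, b)\<in>A \<times> A. of_bool (a = d) * h b * f a b) = (\<Sum>b\<in>A. h b * f d b)"
proof -
  have "(\<Sum>(a, b)\<in>A \<times> A. of_bool (a = d) * h b * f a b)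
      = (\<Sum>b\<in>A. \<Sum>a\<in>A. if a = d then h b * f a b else 0)"
    by (subst sum.swap, subst sum.cartesian_product)
       (auto simp del: sum.delta sum.delta' intro!: sum.cong)
  then show ?thesis
    using assms by simp
qed

lemma sum_square_fix_snd:
  fixes h :: "nat \<Rightarrow> int"
  assumes "d \<in> A" "finite A"
  shows "(\<Sum>(a, b)\<in>A \<times> A. of_bool (b = d) * h a * f a b) = (\<Sum>a\<in>A. h a * f a d)"
proof -
  have "(\<Sum>(a, b)\<in>A \<times> A. of_bool (b = d) * h a * f a b)
      = (\<Sum>a\<in>A. \<Sum>b\<in>A. if b = d then h a * f a b else 0)"
    by (subst sum.cartesian_product) (auto simp del: sum.delta sum.delta' intro!: sum.cong)
  then show ?thesis
    using assms by simp
qed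

text \<open>After reindexing by the transposition, the two lengths differ only in the pairs of positions whose
  order the transposition reverses. These are \<open>{i, c}\<close> itself and the pairs \<open>{i, p}\<close> and \<open>{p, c}\<close> with
  \<open>i < p < c\<close>. The latter two cancel unless the value at \<open>p\<close> lies between the exchanged ones, and then
  they contribute 2.\<close>

lemma perm_length_transpose:
  assumes "1 \<le> i" "i < c" "c \<le> n" and "inj u" and u: "u i < u c"
  shows "perm_length n (u \<circ> transpose i c) = perm_length n u + 1 + 2 * num_between u i c (u i) (u c)"
proof -
  let ?t = "transpose i c" and ?S = "{1..n} \<times> {1..n}"
  define m where "m p = (of_bool (i < p \<and> p < c) :: int)" for p
  define e where "e p p' = (of_bool (p = p') :: int)" for p p' :: nat
  define v where "v a b = (of_bool (u a > u b) :: int)" for a b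
  have bij: "bij_betw (map_prod ?t ?t) ?S ?S"
    using assms by (intro bij_betw_map_prod) (auto simp: permutes_swap_id permutes_imp_bij)
  \<comment> \<open>the change in the order of two positions, split according to which of the two is moved\<close>
  have shift: "(of_bool (?t a < ?t b) - of_bool (a < b) :: int)
      = e a c * (e b i + m b) - e a i * (e b c + m b) + e b i * m a - e b c * m a" for a b
    using \<open>i < c\<close> unfolding e_def m_def
    by (cases "a = i"; cases "a = c"; cases "b = i"; cases "b = c") (simp_all add: of_bool_def)
  have len_new: "int (perm_length n (u \<circ> ?t)) = (\<Sum>(a, b)\<in>?S. of_bool (?t a < ?t b) * v a b)"
    unfolding perm_length_eq_sum v_def
    by (subst sum.reindex_bij_betw[OF bij, symmetric]) (simp add: case_prod_beta)
  have len_old: "int (perm_length n u) = (\<Sum>(a, b)\<in>?S. of_bool (a < b) * v a b)"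
    unfolding v_def by (rule perm_length_eq_sum)
  have "int (perm_length n (u \<circ> ?t)) - int (perm_length n u)
      = (\<Sum>(a, b)\<in>?S. (of_bool (?t a < ?t b) - of_bool (a < b)) * v a b)"
    unfolding len_new len_old sum_subtractf[symmetric]
    by (intro sum.cong) (auto simp: left_diff_distrib)
  also have "\<dots> = (\<Sum>(a, b)\<in>?S. e a c * (e b i + m b) * v a b - e a i * (e b c + m b) * v a b
      + e b i * m a * v a b - e b c * m a * v a b)"
    by (simp only: shift left_diff_distrib distrib_right)
  also have "\<dots> = (\<Sum>(a, b)\<in>?S. e a c * (e b i + m b) * v a b)
      - (\<Sum>(a, b)\<in>?S. e a i * (e b c + m b) * v a b)
      + (\<Sum>(a, b)\<in>?S. e b i * m a * v a b) - (\<Sum>(a, b)\<in>?S. e b c * m a * v a b)"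
    by (simp add: case_prod_unfold sum_subtractf sum.distrib)
  also have "\<dots> = (\<Sum>b\<in>{1..n}. (e b i + m b) * v c b) - (\<Sum>b\<in>{1..n}. (e b c + m b) * v i b)
      + (\<Sum>a\<in>{1..n}. m a * v a i) - (\<Sum>a\<in>{1..n}. m a * v a c)"
    unfolding e_def using assms
    by (intro arg_cong2[of _ _ _ _ "(-)"] arg_cong2[of _ _ _ _ "(+)"]
        sum_square_fix_fst sum_square_fix_snd) auto
  also have "\<dots> = (\<Sum>b\<in>{1..n}. (e b i + m b) * v c b - (e b c + m b) * v i b + m b * v b i - m b * v b c)"
    by (simp add: sum_subtractf sum.distrib)
  also have "\<dots> = (\<Sum>b\<in>{1..n}. of_bool (b = i)
      + 2 * of_bool (i < b \<and> b < c \<and> between (u i) (u c) (u b)))"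
  proof (intro sum.cong refl)
    fix b
    show "(e b i + m b) * v c b - (e b c + m b) * v i b + m b * v b i - m b * v b c
        = of_bool (b = i) + 2 * of_bool (i < b \<and> b < c \<and> between (u i) (u c) (u b))"
    proof (cases "i < b \<and> b < c")
      case True
      then have "u b \<noteq> u i" "u b \<noteq> u c"
        using \<open>inj u\<close> by (auto dest: injD)
      then consider "u b < u i" | "u i < u b" "u b < u c" | "u c < u b"
        by linarith
      then show ?thesis
        using True u by cases (auto simp: e_def m_def v_def between_def)
    next
      case False
      then have "m b = 0"
        by (simp add: m_def)
      then show ?thesis
        using False u \<open>i < c\<close> by (auto simp: e_def v_def)
    qed
  qed
  also have "\<dots> = 1 + 2 * int (card {b \<in> {1..n}. i < b \<and> b < c \<and> between (u i) (u c) (u b)})"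
    using assms by (simp add: sum.distrib sum_distrib_left[symmetric] Int_def of_bool_def[of "_ = _"])
  also have "{b \<in> {1..n}. i < b \<and> b < c \<and> between (u i) (u c) (u b)}
      = {b. i < b \<and> b < c \<and> between (u i) (u c) (u b)}"
    using assms by auto
  finally show ?thesis
    unfolding num_between_def comp_def by linarith
qed

lemma transpose_comp_transpose: "u \<circ> transpose a b \<circ> transpose a b = u"
  by (simp add: comp_assoc)

lemma bruhat_less_imp_length_less: "bruhat_less n u v \<Longrightarrow> perm_length n u < perm_length n v"
  unfolding bruhat_less_def
  by (induction rule: tranclp_induct) (elim exE conjE, simp only:, elim exE conjE, simp only: less_trans)

text \<open>This turns the Bruhat order in the definition of a positive folding into a comparison of lengths.\<close>

lemma bruhat_less_transpose_iff:
  assumes "1 \<le> a" "a < b" "b \<le> n"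
  shows "bruhat_less n u (u \<circ> transpose a b) \<longleftrightarrow> perm_length n u < perm_length n (u \<circ> transpose a b)"
  using assms bruhat_less_imp_length_less unfolding bruhat_less_def
  by (blast intro: tranclp.r_into_trancl)

section \<open>The weight of an exchange\<close>

text \<open>The weight with which an entry \<open>a\<close> is replaced by \<open>b\<close> when the distance of the two positions is \<open>d\<close>,
  the arm is \<open>A\<close>, and \<open>N\<close> entries in between have values between \<open>a\<close> and \<open>b\<close>. The chain is read
  backwards here, so an ascent \<open>a < b\<close> belongs to a positive folding.\<close>

definition swap_factor :: "nat \<Rightarrow> nat \<Rightarrow> nat \<Rightarrow> nat \<Rightarrow> nat \<Rightarrow> qt_field" where
  "swap_factor A d a b N =
     (if a < b then t_var powi int N else t_var powi (- int N - 1) * (q_var ^ A * t_var ^ d))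
     * ((1 - t_var) / (1 - q_var ^ A * t_var ^ d))"

lemma swap_factor_alt:
  "swap_factor A d a b N =
     (if a < b then t_var ^ N else q_var ^ A * t_var ^ d / (t_var ^ N * t_var))
     * ((1 - t_var) / (1 - q_var ^ A * t_var ^ d))"
  using t_var_nonzero
  by (simp add: swap_factor_def power_int_diff power_int_minus divide_inverse)

text \<open>The identity that collapses the sum over all foldings. Let \<open>e\<close> be the entry at the first position that
  may be exchanged with \<open>a\<close>, at distance \<open>d\<close>. Either the exchange is omitted, and the remaining positions
  start at distance \<open>d + 1\<close> with \<open>e\<close> added to the entries in between, or it is made, and then \<open>e\<close> has to
  be replaced by \<open>b\<close> with \<open>a\<close> added to the entries in between. The sum is again a single
  exchange weight, independent of \<open>e\<close>. The hypotheses on the counts say that the values between two of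
  \<open>a\<close>, \<open>e\<close>, \<open>b\<close> are split by the third. In each of the six orders of \<open>a\<close>, \<open>e\<close>, \<open>b\<close> the claim is a
  multiple of one of two identities \<open>t C + D C = D\<close> and \<open>C + x D C = D\<close>.\<close>

lemma swap_factor_compose:
  assumes d: "0 < d"
    and ne: "a \<noteq> e" "e \<noteq> b" "a \<noteq> b"
    and N1: "between a b e \<Longrightarrow> Nab = Nae + Neb"
    and N2: "between a e b \<Longrightarrow> Nae = Nab + Neb"
    and N3: "between e b a \<Longrightarrow> Neb = Nae + Nab"
  shows "swap_factor A (Suc d) a b (Nab + of_bool (between a b e))
       + swap_factor A d a e Nae * swap_factor A (Suc d) e b (Neb + of_bool (between e b a))
       = swap_factor A d a b Nab" (is "?lhs = _")
proof -
  define x where "x = q_var ^ A * t_var ^ d"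
  define C where "C = (1 - t_var) / (1 - x * t_var)"
  define D where "D = (1 - t_var) / (1 - x)"
  have x': "q_var ^ A * t_var ^ Suc d = x * t_var"
    by (simp add: x_def)
  have nz: "1 - x \<noteq> 0" "1 - x * t_var \<noteq> 0"
    using qt_monomial_neq_1[of d A] qt_monomial_neq_1[of "Suc d" A] d
    by (auto simp: x_def ac_simps)
  note t0 = t_var_nonzero
  have t_C: "t_var * C + D * C = D"
    using nz by (simp add: C_def D_def divide_simps) (simp add: algebra_simps)
  have x_C: "C + x * D * C = D"
    using nz by (simp add: C_def D_def divide_simps) (simp add: algebra_simps)
  note defs = swap_factor_alt x' x_def[symmetric] C_def[symmetric] D_def[symmetric]
  consider "a < e" "e < b" | "a < b" "b < e" | "e < a" "a < b"
    | "b < e" "e < a" | "e < b" "b < a" | "b < a" "a < e"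
    using ne by linarith
  then show ?thesis
  proof cases
    case 1
    then have N: "Nab = Nae + Neb" using N1 by (auto simp: between_def)
    have "?lhs = t_var ^ Nae * t_var ^ Neb * (t_var * C + D * C)"
      using 1 t0 unfolding N defs by (simp add: between_def power_add field_simps)
    then show ?thesis
      using 1 unfolding t_C N defs by (simp add: between_def power_add)
  next
    case 2
    then have N: "Nae = Nab + Neb" using N2 by (auto simp: between_def)
    have "?lhs = t_var ^ Nab * (C + x * D * C)"
      using 2 t0 unfolding N defs by (simp add: between_def power_add field_simps)
    then show ?thesis
      using 2 unfolding x_C N defs by (simp add: between_def power_add)
  next
    case 3
    then have N: "Neb = Nae + Nab" using N3 by (auto simp: between_def)
    have "?lhs = t_var ^ Nab * (C + x * D * C)"
      using 3 t0 unfolding N defs by (simp add: between_def power_add field_simps)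
    then show ?thesis
      using 3 unfolding x_C N defs by (simp add: between_def power_add)
  next
    case 4
    then have N: "Nab = Nae + Neb" using N1 by (auto simp: between_def)
    have "?lhs = x / (t_var ^ Nae * t_var ^ Neb * t_var) * (C + x * D * C)"
      using 4 t0 unfolding N defs by (simp add: between_def power_add field_simps)
    then show ?thesis
      using 4 unfolding x_C N defs by (simp add: between_def power_add)
  next
    case 5
    then have N: "Nae = Nab + Neb" using N2 by (auto simp: between_def)
    have "?lhs = x / (t_var ^ Nab * t_var) * (t_var * C + D * C)"
      using 5 t0 unfolding N defs by (simp add: between_def power_add field_simps)
    then show ?thesis
      using 5 unfolding t_C N defs by (simp add: between_def power_add)
  next
    case 6
    then have N: "Neb = Nae + Nab" using N3 by (auto simp: between_def)
    have "?lhs = x / (t_var ^ Nab * t_var) * (t_var * C + D * C)"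
      using 6 t0 unfolding N defs by (simp add: between_def power_add field_simps)
    then show ?thesis
      using 6 unfolding t_C N defs by (simp add: between_def power_add)
  qed
qed

text \<open>The contribution of one chosen entry of the chain, in terms of the permutation \<open>u\<close> that has absorbed
  all reflections up to and including this one. The permutation before it is \<open>u'\<close>, so the folding is
  positive when \<open>u\<close> is the shorter of the two. The division by 2 is exact.\<close>

definition step_weight :: "nat \<Rightarrow> (nat \<Rightarrow> nat) \<Rightarrow> nat \<times> nat \<times> nat \<Rightarrow> (nat \<Rightarrow> nat) \<Rightarrow> qt_field" where
  "step_weight n lam = (\<lambda>(j, i, c) u.
     let u' = u \<circ> transpose i c; x = q_var ^ arm lam (i, j - 1) * t_var ^ (c - i) in
     t_var powi ((int (perm_length n u') - int (perm_length n u) - 1) div 2) * (1 - t_var)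
     * ((if perm_length n u < perm_length n u' then 1 else x) / (1 - x)))"

text \<open>In the exponent, half the change of length minus one is \<open>N\<close> for an ascent and \<open>- N - 1\<close> for a descent.\<close>

lemma step_weight_eq_swap_factor:
  assumes "1 \<le> i" "i < c" "c \<le> n" and inj: "inj u"
  shows "step_weight n lam (j, i, c) u
    = swap_factor (arm lam (i, j - 1)) (c - i) (u i) (u c) (num_between u i c (u i) (u c))"
proof (cases "u i < u c")
  case True
  then show ?thesis
    using perm_length_transpose[of i c n u] assms
    by (simp add: step_weight_def swap_factor_def Let_def)
next
  case False
  then have "u c < u i"
    using inj_eq[OF inj, of i c] assms by simp
  have "inj (u \<circ> transpose i c)"
    using inj by (simp add: inj_compose)
  let ?u' = "u \<circ> transpose i c" and ?N = "num_between u i c (u i) (u c)"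
  have "num_between ?u' i c (?u' i) (?u' c) = ?N"
    unfolding num_between_def between_def using \<open>i < c\<close>
    by (intro arg_cong[of _ _ card]) (auto simp: min.commute max.commute)
  then have "perm_length n u = perm_length n ?u' + 1 + 2 * ?N"
    using perm_length_transpose[of i c n ?u'] assms False \<open>u c < u i\<close> \<open>inj ?u'\<close> transpose_comp_transpose[of u i c] by simp
  then have "(int (perm_length n ?u') - int (perm_length n u) - 1) div 2 = - int ?N - 1"
      and "\<not> perm_length n u < perm_length n ?u'"
    by simp_all
  then show ?thesis
    using False assms by (simp add: step_weight_def swap_factor_def Let_def)
qed

section \<open>Summation over one row of roots\<close>

text \<open>The sum over all subsets of the list \<open>es\<close>, which runs through the chain backwards. Its argument \<open>F\<close> is
  applied to the permutation that the chosen reflections lead to, and stands for the sum over the rest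
  of the chain.\<close>

primrec fold_sum ::
    "nat \<Rightarrow> (nat \<Rightarrow> nat) \<Rightarrow> (nat \<times> nat \<times> nat) list \<Rightarrow> ((nat \<Rightarrow> nat) \<Rightarrow> qt_field) \<Rightarrow> (nat \<Rightarrow> nat) \<Rightarrow> qt_field" where
  "fold_sum n lam [] F u = F u"
| "fold_sum n lam (e # es) F u = fold_sum n lam es F u
     + step_weight n lam e u * fold_sum n lam es F (u \<circ> root_transposition (snd e))"

lemma fold_sum_append: "fold_sum n lam (es @ es') F = fold_sum n lam es (fold_sum n lam es' F)"
proof
  show "fold_sum n lam (es @ es') F u = fold_sum n lam es (fold_sum n lam es' F) u" for u
    by (induction es arbitrary: u) auto
qed

text \<open>An entry at a position that no remaining root involves can never be corrected.\<close>

lemma fold_sum_eq_0: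
  assumes "\<And>u'. u' permutes {1..n} \<Longrightarrow> u' p = u p \<Longrightarrow> F u' = 0"
    and "\<And>j i c. (j, i, c) \<in> set es \<Longrightarrow> i \<in> {1..n} - {p} \<and> c \<in> {1..n} - {p}"
    and "u permutes {1..n}"
  shows "fold_sum n lam es F u = 0"
  using assms
proof (induction es arbitrary: u)
  case (Cons e es)
  obtain j i c where e: "e = (j, i, c)" by (cases e)
  have ic: "i \<in> {1..n} - {p}" "c \<in> {1..n} - {p}"
    using Cons.prems(2)[of j i c] by (auto simp: e)
  then have "(u \<circ> root_transposition (snd e)) p = u p"
    by (auto simp: e root_transposition_def transpose_def)
  moreover have "u \<circ> root_transposition (snd e) permutes {1..n}"
    using ic Cons.prems unfolding e root_transposition_def
    by (auto intro!: permutes_compose permutes_swap_id)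
  moreover have "fold_sum n lam es F u' = 0" if "u' p = u p" "u' permutes {1..n}" for u'
    using Cons.prems that by (intro Cons.IH) auto
  ultimately show ?case
    using Cons.prems by simp
qed auto

text \<open>All foldings of a row that bring \<open>b\<close> to position \<open>i\<close>. The rest \<open>F\<close> of the sum is assumed
  to take one value \<open>G\<close> on them and to vanish on the other outcomes, as long as the positions before
  \<open>c0\<close> other than \<open>i\<close> are untouched, which exchanges with later positions guarantee. If \<open>b\<close> is at \<open>i\<close> already,
  every exchange would put it at a position that is not visited again. If \<open>b\<close> is at another position
  before \<open>c\<close>, it cannot be reached. Otherwise, omitting or using the root \<open>(i, c)\<close> gives the two terms of
  \<open>swap_factor_compose\<close>. The first column \<open>c\<close> varies in the induction, whereas \<open>c0\<close> stays fixed.\<close>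

lemma fold_sum_row:
  fixes j i c n :: nat
  assumes F: "\<And>u'. u' permutes {1..n} \<Longrightarrow> \<forall>p<c0. p \<noteq> i \<longrightarrow> u' p = f p \<Longrightarrow>
                 F u' = (if u' i = b then G else 0)"
    and i: "1 \<le> i" "i < c0" "c0 \<le> c"
    and u: "u permutes {1..n}" "\<forall>p<c0. p \<noteq> i \<longrightarrow> u p = f p"
    and pos: "u p = b" "p \<le> n"
  shows "fold_sum n lam (map (\<lambda>c. (j, i, c)) [c..<n+1]) F u =
     (if p = i then G
      else if p < c then 0
      else swap_factor (arm lam (i, j - 1)) (c - i) (u i) b (num_between u i c (u i) b) * G)"
  using i(3) u pos
proof (induction "n + 1 - c" arbitrary: c u p)
  case 0
  then have "u i = b \<longleftrightarrow> p = i"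
    using permutes_inj[OF "0.prems"(2)] by (auto dest: injD)
  then show ?case
    using 0 F[of u] by auto
next
  case (Suc l)
  let ?t = "transpose i c" and ?A = "arm lam (i, j - 1)"
  let ?S = "\<lambda>u. fold_sum n lam (map (\<lambda>c. (j, i, c)) [Suc c..<n+1]) F u"
  have c: "1 \<le> i" "i < c" "c \<le> n" "l = n + 1 - Suc c"
    using Suc.hyps i Suc.prems by auto
  have inj: "inj u"
    using Suc.prems permutes_inj by blast
  have t_perm: "u \<circ> ?t permutes {1..n}"
    using c Suc.prems by (intro permutes_compose permutes_swap_id) auto
  have t_fix: "\<forall>p<c0. p \<noteq> i \<longrightarrow> (u \<circ> ?t) p = f p"
    using Suc.prems by (auto simp: transpose_def)
  have split: "fold_sum n lam (map (\<lambda>c. (j, i, c)) [c..<n+1]) F u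
      = ?S u + step_weight n lam (j, i, c) u * ?S (u \<circ> ?t)"
    using c by (simp add: upt_conv_Cons root_transposition_def del: upt_Suc)
  have stay: "?S u = (if p = i then G else if p < Suc c then 0
      else swap_factor ?A (Suc c - i) (u i) b (num_between u i (Suc c) (u i) b) * G)"
    using Suc.prems c by (intro Suc.hyps(1)) auto
  have swap: "?S (u \<circ> ?t) = (if ?t p = i then G else if ?t p < Suc c then 0
      else swap_factor ?A (Suc c - i) ((u \<circ> ?t) i) b
            (num_between (u \<circ> ?t) i (Suc c) ((u \<circ> ?t) i) b) * G)"
    using Suc.prems c t_perm t_fix by (intro Suc.hyps(1)) (auto simp: transpose_def)
  have ne: "u i \<noteq> u c"
    using c inj by (auto dest: injD)
  have step: "step_weight n lam (j, i, c) u
      = swap_factor ?A (c - i) (u i) (u c) (num_between u i c (u i) (u c))"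
    using c inj by (intro step_weight_eq_swap_factor)
  consider "p = i" | "p \<noteq> i" "p < c" | "p = c" | "c < p"
    by linarith
  then show ?case
  proof cases
    case 1
    then show ?thesis
      using split stay swap c by simp
  next
    case 2
    then show ?thesis
      using split stay swap c by (simp add: transpose_def)
  next
    case 3
    then show ?thesis
      using split stay swap step c Suc.prems by simp
  next
    case 4
    have nb: "u i \<noteq> b" "u c \<noteq> b"
      using 4 c Suc.prems inj by (auto dest: injD)
    have count: "num_between (u \<circ> ?t) i c x y = num_between u i c x y" for x y
      unfolding num_between_def by (intro arg_cong[of _ _ card]) (auto simp: transpose_def)
    have disj: "num_between u i c x z = num_between u i c x y + num_between u i c y z"
      if "between x z y" "\<forall>p. i < p \<and> p < c \<longrightarrow> u p \<noteq> y" for x y z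
    proof -
      have "{p. i < p \<and> p < c \<and> between x z (u p)}
          = {p. i < p \<and> p < c \<and> between x y (u p)} \<union> {p. i < p \<and> p < c \<and> between y z (u p)}"
        using that by (auto simp: between_def)
      moreover have "{p. i < p \<and> p < c \<and> between x y (u p)} \<inter> {p. i < p \<and> p < c \<and> between y z (u p)} = {}"
        using that by (auto simp: between_def)
      ultimately show ?thesis
        by (simp add: num_between_def card_Un_disjoint)
    qed
    have comm: "num_between u i c x y = num_between u i c y x" for x y
      by (simp add: num_between_def between_def min.commute max.commute)
    \<comment> \<open>no entry in between has one of the three values, which are distinct, so the counts add up\<close>
    have off: "\<forall>p. i < p \<and> p < c \<longrightarrow> u p \<noteq> u i" "\<forall>p. i < p \<and> p < c \<longrightarrow> u p \<noteq> u c"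
        "\<forall>p'. i < p' \<and> p' < c \<longrightarrow> u p' \<noteq> b"
      using 4 Suc.prems inj by (auto dest: injD)
    have compose: "swap_factor ?A (Suc (c - i)) (u i) b (num_between u i c (u i) b + of_bool (between (u i) b (u c)))
       + swap_factor ?A (c - i) (u i) (u c) (num_between u i c (u i) (u c))
         * swap_factor ?A (Suc (c - i)) (u c) b (num_between u i c (u c) b + of_bool (between (u c) b (u i)))
       = swap_factor ?A (c - i) (u i) b (num_between u i c (u i) b)"
      using c ne nb off disj comm
      by (intro swap_factor_compose) (auto, metis+)
    have "Suc c - i = Suc (c - i)"
      using c by simp
    then have "fold_sum n lam (map (\<lambda>c. (j, i, c)) [c..<n+1]) F u =
      (swap_factor ?A (Suc (c - i)) (u i) b (num_between u i c (u i) b + of_bool (between (u i) b (u c)))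
       + swap_factor ?A (c - i) (u i) (u c) (num_between u i c (u i) (u c))
         * swap_factor ?A (Suc (c - i)) (u c) b (num_between u i c (u c) b + of_bool (between (u c) b (u i)))) * G"
      using 4 c split stay swap step count by (simp add: num_between_Suc algebra_simps)
    then show ?thesis
      using 4 c compose by simp
  qed
qed

section \<open>The diagram of a regular partition\<close>

locale regular_shape =
  fixes n :: nat and lam :: "nat \<Rightarrow> nat"
  assumes n_ge_2: "2 \<le> n"
    and regular: "regular_partition n lam"
begin

abbreviation height :: "nat \<Rightarrow> nat" where
  "height \<equiv> conjugate lam"

lemma lam_eq_0: "n \<le> i \<Longrightarrow> lam i = 0"
  using regular by (simp add: regular_partition_def)

lemma lam_Suc_less: "1 \<le> i \<Longrightarrow> i < n \<Longrightarrow> lam (Suc i) < lam i"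
  using regular by (simp add: regular_partition_def)

lemma lam_less: "1 \<le> i \<Longrightarrow> i < k \<Longrightarrow> i < n \<Longrightarrow> lam k < lam i"
proof (induction k)
  case (Suc k)
  show ?case
  proof (cases "i = k")
    case True
    then show ?thesis using Suc.prems lam_Suc_less by simp
  next
    case False
    then have "lam k < lam i" using Suc by simp
    moreover have "lam (Suc k) \<le> lam k"
      using lam_Suc_less[of k] lam_eq_0[of "Suc k"] Suc.prems by (cases "k < n") auto
    ultimately show ?thesis by simp
  qed
qed simp

text \<open>Strictness of \<open>\<lambda>\<close> enters here: every cell above another cell has a neighbour in the next column.\<close>

lemma diagram_above:
  assumes "(k, j) \<in> diagram lam" "1 \<le> i" "i < k"
  shows "(i, j) \<in> diagram lam" "(i, Suc j) \<in> diagram lam"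
proof -
  have "k < n"
    using assms lam_eq_0[of k] by (cases "k < n") (auto simp: diagram_def)
  then show "(i, j) \<in> diagram lam" "(i, Suc j) \<in> diagram lam"
    using assms lam_less[of i k] by (auto simp: diagram_def)
qed

lemma finite_column: "1 \<le> j \<Longrightarrow> finite {i. 1 \<le> i \<and> j \<le> lam i}"
proof (rule finite_subset)
  assume "1 \<le> j"
  show "{i. 1 \<le> i \<and> j \<le> lam i} \<subseteq> {..<n}"
  proof
    fix i assume "i \<in> {i. 1 \<le> i \<and> j \<le> lam i}"
    then show "i \<in> {..<n}"
      using lam_eq_0[of i] \<open>1 \<le> j\<close> by (cases "n \<le> i") auto
  qed
qed simp

lemma column_eq:
  assumes "1 \<le> j"
  shows "{i. 1 \<le> i \<and> j \<le> lam i} = {1..height j}"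
proof (cases "{i. 1 \<le> i \<and> j \<le> lam i} = {}")
  case True
  then have "height j = 0"
    unfolding conjugate_def by (simp only: card.empty)
  with True show ?thesis by simp
next
  case False
  let ?A = "{i. 1 \<le> i \<and> j \<le> lam i}"
  define M where "M = Max ?A"
  have "M \<in> ?A"
    unfolding M_def using finite_column[OF assms] False by (rule Max_in)
  have down: "j \<le> lam i" if "1 \<le> i" "i \<le> M" for i
    using diagram_above(1)[of M j i] \<open>M \<in> ?A\<close> that assms
    by (cases "i = M") (auto simp: diagram_def)
  have up: "i \<le> M" if "i \<in> ?A" for i
    unfolding M_def using finite_column[OF assms] that by (rule Max_ge)
  have "?A = {1..M}"
  proof (intro equalityI subsetI)
    show "i \<in> {1..M}" if "i \<in> ?A" for i
      using that up[OF that] by simp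
    show "i \<in> ?A" if "i \<in> {1..M}" for i
      using that down[of i] by simp
  qed
  then show ?thesis
    unfolding conjugate_def by (metis card_atLeastAtMost diff_Suc_1)
qed

lemma le_height_iff: "1 \<le> j \<Longrightarrow> 1 \<le> i \<Longrightarrow> i \<le> height j \<longleftrightarrow> j \<le> lam i"
  using column_eq[of j] by (auto simp: set_eq_iff)

lemma mem_diagram_iff: "(i, j) \<in> diagram lam \<longleftrightarrow> 1 \<le> j \<and> i \<in> {1..height j}"
  using le_height_iff by (auto simp: diagram_def)

lemma height_less: "1 \<le> j \<Longrightarrow> height j < n"
  using le_height_iff[of j n] lam_eq_0[of n] n_ge_2 by (cases "height j < n") auto

lemma height_1: "height 1 = n - 1"
proof (rule antisym)
  show "height 1 \<le> n - 1"
    using height_less[of 1] by simp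
  show "n - 1 \<le> height 1"
    using le_height_iff[of 1 "n - 1"] lam_Suc_less[of "n - 1"] n_ge_2 by fastforce
qed

lemma height_Suc_le: "1 \<le> j \<Longrightarrow> height (Suc j) \<le> height j"
  using le_height_iff[of j "height (Suc j)"] le_height_iff[of "Suc j" "height (Suc j)"]
  by (cases "height (Suc j) = 0") auto

text \<open>By \<open>diagram_above\<close>, two cells of column \<open>j\<close> cannot both end their rows.\<close>

lemma height_le_Suc:
  assumes "1 \<le> j"
  shows "height j \<le> Suc (height (Suc j))"
proof (rule ccontr)
  assume "\<not> ?thesis"
  then have "Suc (Suc (height (Suc j))) \<le> height j"
    by simp
  then have "(Suc (Suc (height (Suc j))), j) \<in> diagram lam"
    using assms by (simp add: mem_diagram_iff)
  then have "(Suc (height (Suc j)), Suc j) \<in> diagram lam"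
    by (intro diagram_above(2)) auto
  then show False
    by (simp add: mem_diagram_iff)
qed

lemma height_antimono: "1 \<le> i \<Longrightarrow> i \<le> j \<Longrightarrow> height j \<le> height i"
proof (induction j)
  case (Suc j)
  then show ?case
    using height_Suc_le[of j] by (cases "i = Suc j") auto
qed simp

lemma height_pos: "1 \<le> j \<Longrightarrow> j \<le> lam 1 \<Longrightarrow> 1 \<le> height j"
  using le_height_iff[of j 1] by simp

lemma leg_eq: "(i, j) \<in> diagram lam \<Longrightarrow> leg lam (i, j) = height j - i"
proof -
  assume "(i, j) \<in> diagram lam"
  then have "{i'. (i', j) \<in> diagram lam \<and> i < i'} = {Suc i..height j}"
    by (auto simp: mem_diagram_iff)
  then show ?thesis
    by (simp add: leg_def)
qed

section \<open>The chain of roots read backwards\<close>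

text \<open>The factor \<open>\<Gamma>\<^sub>j\<close> in reverse order. The columns start beyond the height of column \<open>j - 1\<close>, which covers
  both \<open>\<Gamma>(k)\<close> and \<open>\<Gamma>'(k)\<close>; see \<open>Gamma_factor_eq\<close>.\<close>

definition column_steps :: "nat \<Rightarrow> (nat \<times> nat \<times> nat) list" where
  "column_steps j =
     concat (map (\<lambda>i. map (\<lambda>c. (j, i, c)) [height (j - 1) + 1..<n+1]) [1..<height j + 1])"

text \<open>The reduced factor is used exactly when the height has just dropped, and then it drops by one.\<close>

lemma first_column_of_height:
  assumes "1 \<le> j"
  shows "Suc j = (LEAST i. 1 \<le> i \<and> height i = height (Suc j)) \<longleftrightarrow> height j = Suc (height (Suc j))"
proof
  assume least: "Suc j = (LEAST i. 1 \<le> i \<and> height i = height (Suc j))"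
  have "height j \<noteq> height (Suc j)"
  proof
    assume "height j = height (Suc j)"
    then have "(LEAST i. 1 \<le> i \<and> height i = height (Suc j)) \<le> j"
      using assms by (intro Least_le) auto
    then show False using least by simp
  qed
  then show "height j = Suc (height (Suc j))"
    using height_Suc_le[OF assms] height_le_Suc[OF assms] by simp
next
  assume drop: "height j = Suc (height (Suc j))"
  have "(LEAST i. 1 \<le> i \<and> height i = height (Suc j)) = Suc j"
  proof (rule Least_equality)
    fix i assume i: "1 \<le> i \<and> height i = height (Suc j)"
    show "Suc j \<le> i"
    proof (rule ccontr)
      assume "\<not> Suc j \<le> i"
      then have "height j \<le> height i"
        using i height_antimono[of i j] by simp
      then show False using i drop by simp
    qed
  qed simp
  then show "Suc j = (LEAST i. 1 \<le> i \<and> height i = height (Suc j))"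
    by simp
qed

lemma Gamma_full_eq:
  "Gamma_full n k = rev (concat (map (\<lambda>i. map (Pair i) [k+1..<n+1]) [1..<k+1]))"
  by (simp add: Gamma_full_def rev_concat rev_map comp_def del: upt_Suc)

lemma Gamma_factor_eq:
  assumes "1 \<le> j"
  shows "map (Pair (Suc j)) (Gamma_factor n lam (Suc j)) = rev (column_steps (Suc j))"
proof -
  let ?k = "height (Suc j)"
  have "Gamma_factor n lam (Suc j)
      = rev (concat (map (\<lambda>i. map (Pair i) [height j + 1..<n+1]) [1..<?k+1]))"
  proof (cases "height j = Suc ?k")
    case True
    have "filter (\<lambda>c. c \<noteq> Suc ?k) [Suc ?k..<Suc n] = [Suc (Suc ?k)..<Suc n]"
    proof -
      have "?k < n" using height_less by simp
      then have "[Suc ?k..<Suc n] = Suc ?k # [Suc (Suc ?k)..<Suc n]"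
        by (subst upt_conv_Cons) auto
      then show ?thesis
        by (simp add: filter_id_conv del: upt_Suc)
    qed
    then show ?thesis
      using True first_column_of_height[OF assms]
      by (simp add: Gamma_factor_def Gamma_reduced_def Gamma_full_eq rev_filter[symmetric]
          filter_concat filter_map comp_def del: upt_Suc)
  next
    case False
    then have "height j = ?k"
      using height_Suc_le[OF assms] height_le_Suc[OF assms] by simp
    then show ?thesis
      using False first_column_of_height[OF assms]
      by (simp add: Gamma_factor_def Gamma_full_eq del: upt_Suc)
  qed
  then show ?thesis
    by (simp add: column_steps_def rev_map[symmetric] map_concat comp_def del: upt_Suc)
qed

text \<open>The part \<open>\<Gamma>\<^bsub>lam 1\<^esub> \<dots> \<Gamma>\<^bsub>j+1\<^esub>\<close> of the chain. The filling map reads column \<open>j\<close> right after it.\<close>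

definition chain_prefix :: "nat \<Rightarrow> (nat \<times> nat \<times> nat) list" where
  "chain_prefix j = concat (map (\<lambda>j'. rev (column_steps j')) (rev [Suc j..<lam 1 + 1]))"

lemma chain_prefix_1: "chain_prefix 1 = Gamma_chain n lam"
proof -
  have "map (Pair j) (Gamma_factor n lam j) = rev (column_steps j)" if "2 \<le> j" for j
    using Gamma_factor_eq[of "j - 1"] that by simp
  then show ?thesis
    unfolding chain_prefix_def Gamma_chain_def
    by (intro arg_cong[of _ _ concat]) (auto simp: numeral_2_eq_2 simp del: upt_Suc)
qed

lemma chain_prefix_last: "chain_prefix (lam 1) = []"
  by (simp add: chain_prefix_def)

lemma chain_prefix_Suc:
  "j < lam 1 \<Longrightarrow> chain_prefix j = chain_prefix (Suc j) @ rev (column_steps (Suc j))"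
  by (simp add: chain_prefix_def upt_conv_Cons del: upt_Suc)

lemma set_column_steps:
  assumes "1 \<le> j"
  shows "set (column_steps (Suc j))
    = {(j', i, c). j' = Suc j \<and> i \<in> {1..height (Suc j)} \<and> c \<in> {height j + 1..n}}"
  by (force simp: column_steps_def simp del: upt_Suc)

lemma column_steps_nonempty:
  assumes "1 \<le> j" "j < lam 1"
  shows "column_steps (Suc j) \<noteq> []"
proof -
  have "(Suc j, 1, n) \<in> set (column_steps (Suc j))"
    using assms height_pos[of "Suc j"] height_less[of j] by (simp add: set_column_steps)
  then show ?thesis
    by auto
qed

text \<open>The sum over those subsets of a reversed prefix of the chain for which the permutation \<open>u\<close> passed
  when \<open>s\<close> entries are left satisfies \<open>C s u\<close>, for every \<open>s\<close>. Position \<open>p\<close> of the chain is processed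
  when \<open>p + 1\<close> entries are left, hence the guard \<open>Suc (length es)\<close>.\<close>

primrec guarded_sum ::
    "(nat \<Rightarrow> (nat \<Rightarrow> nat) \<Rightarrow> bool) \<Rightarrow> (nat \<times> nat \<times> nat) list \<Rightarrow> (nat \<Rightarrow> nat) \<Rightarrow> qt_field" where
  "guarded_sum C [] u = of_bool (C 0 u)"
| "guarded_sum C (e # es) u = of_bool (C (Suc (length es)) u) *
     (guarded_sum C es u + step_weight n lam e u * guarded_sum C es (u \<circ> root_transposition (snd e)))"

lemma guarded_sum_append:
  assumes "es \<noteq> []"
    and "\<And>s u. length es' < s \<Longrightarrow> s < length es + length es' \<Longrightarrow> C s u"
  shows "guarded_sum C (es @ es') u
    = of_bool (C (length es + length es') u) * fold_sum n lam es (guarded_sum C es') u"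
  using assms
proof (induction es arbitrary: u)
  case (Cons e es)
  have "guarded_sum C (es @ es') u' = fold_sum n lam es (guarded_sum C es') u'" for u'
  proof (cases "es = []")
    case False
    have "guarded_sum C (es @ es') u'
        = of_bool (C (length es + length es') u') * fold_sum n lam es (guarded_sum C es') u'"
      using Cons.prems False by (intro Cons.IH) auto
    then show ?thesis
      using Cons.prems(2)[of "length es + length es'" u'] False by simp
  qed simp
  then show ?case
    by simp
qed simp

end

section \<open>Summation over one column and over the chain\<close>

locale regular_filling = regular_shape +
  fixes \<sigma> :: "nat \<times> nat \<Rightarrow> nat"
  assumes nonattacking: "\<sigma> \<in> nonattacking_fillings lam n"
begin

lemma filling_range: "u \<in> diagram lam \<Longrightarrow> \<sigma> u \<in> {1..n}"
  using nonattacking by (auto simp: nonattacking_fillings_def)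

lemma filling_attack: "u \<in> diagram lam \<Longrightarrow> v \<in> diagram lam \<Longrightarrow> attacks u v \<Longrightarrow> \<sigma> u \<noteq> \<sigma> v"
  using nonattacking by (auto simp: nonattacking_fillings_def)

lemma filling_same_column:
  "(i, j) \<in> diagram lam \<Longrightarrow> (k, j) \<in> diagram lam \<Longrightarrow> i \<noteq> k \<Longrightarrow> \<sigma> (i, j) \<noteq> \<sigma> (k, j)"
  by (rule filling_attack) (auto simp: attacks_def)

lemma filling_next_column:
  "(i, Suc j) \<in> diagram lam \<Longrightarrow> (k, j) \<in> diagram lam \<Longrightarrow> i < k \<Longrightarrow> \<sigma> (i, Suc j) \<noteq> \<sigma> (k, j)"
  by (rule filling_attack) (auto simp: attacks_def)

text \<open>The total weight of one row of \<open>\<Gamma>\<^bsub>j+1\<^esub>\<close>, attached to the left one \<open>(i, j)\<close> of the two cells that it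
  connects. The first root of the row is \<open>(i, height j + 1)\<close>.\<close>

definition cell_weight :: "nat \<times> nat \<Rightarrow> qt_field" where
  "cell_weight = (\<lambda>(i, j).
     if \<sigma> (i, j) = \<sigma> (i, Suc j) then 1
     else swap_factor (arm lam (i, j)) (height j + 1 - i) (\<sigma> (i, j)) (\<sigma> (i, Suc j))
            (num_between (\<lambda>p. \<sigma> (p, j)) i (height j + 1) (\<sigma> (i, j)) (\<sigma> (i, Suc j))))"

text \<open>The rows from \<open>i\<close> on turn column \<open>j\<close> into column \<open>j + 1\<close>, and the rows before \<open>i\<close> have already done
  so. The nonattacking condition excludes just the positions from which the wanted entry could not be
  fetched: those above \<open>i\<close> hold entries of the same column \<open>j + 1\<close>, and those below hold entries
  of column \<open>j\<close> which attack the cell \<open>(i, j + 1)\<close>.\<close>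

lemma fold_sum_column:
  assumes j: "1 \<le> j"
    and F: "\<And>u. u permutes {1..n} \<Longrightarrow>
      F u = (if \<forall>p\<in>{1..height (Suc j)}. u p = \<sigma> (p, Suc j) then G else 0)"
    and i: "1 \<le> i" "i \<le> height (Suc j) + 1"
    and u: "u permutes {1..n}" "\<forall>p\<in>{i..height j}. u p = \<sigma> (p, j)"
  shows "fold_sum n lam (concat (map (\<lambda>i. map (\<lambda>c. (Suc j, i, c)) [height j + 1..<n+1])
             [i..<height (Suc j) + 1])) F u
    = (if \<forall>p\<in>{1..<i}. u p = \<sigma> (p, Suc j)
       then (\<Prod>i'\<in>{i..height (Suc j)}. cell_weight (i', j)) * G else 0)"
  using i(2,1) u
proof (induction i arbitrary: u rule: inc_induct)
  case base
  have "{1..<height (Suc j) + 1} = {1..height (Suc j)}"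
    by auto
  then show ?case
    using F[OF base(2)] by simp
next
  case (step i)
  let ?row = "\<lambda>i. map (\<lambda>c. (Suc j, i, c)) [height j + 1..<n+1]"
  define rest where "rest = fold_sum n lam (concat (map ?row [Suc i..<height (Suc j) + 1])) F"
  define G' where "G' = (\<Prod>i'\<in>{Suc i..height (Suc j)}. cell_weight (i', j)) * G"
  have ik: "1 \<le> i" "i \<le> height (Suc j)" "height (Suc j) \<le> height j" "height j < n"
    using step j height_Suc_le height_less by auto
  have rest: "rest u' = (if \<forall>p\<in>{1..<Suc i}. u' p = \<sigma> (p, Suc j) then G' else 0)"
    if "u' permutes {1..n}" "\<forall>p\<in>{Suc i..height j}. u' p = u p" for u'
    unfolding rest_def G'_def using step that by (intro step.IH) auto
  have split: "fold_sum n lam (concat (map ?row [i..<height (Suc j) + 1])) F u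
      = fold_sum n lam (?row i) rest u"
    using step.hyps by (simp add: upt_conv_Cons[of i] fold_sum_append rest_def del: upt_Suc)
  show ?case
  proof (cases "\<forall>p\<in>{1..<i}. u p = \<sigma> (p, Suc j)")
    case False
    then obtain p where p: "1 \<le> p" "p < i" "u p \<noteq> \<sigma> (p, Suc j)"
      by auto
    have "fold_sum n lam (?row i @ concat (map ?row [Suc i..<height (Suc j) + 1])) F u = 0"
    proof (rule fold_sum_eq_0[of _ p])
      show "F u' = 0" if "u' permutes {1..n}" "u' p = u p" for u'
        using F[OF that(1)] that p ik by auto
      show "i' \<in> {1..n} - {p} \<and> c \<in> {1..n} - {p}"
        if "(j', i', c) \<in> set (?row i @ concat (map ?row [Suc i..<height (Suc j) + 1]))" for j' i' c
        using that ik p by auto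
    qed fact
    then have "fold_sum n lam (?row i) rest u = 0"
      unfolding rest_def fold_sum_append .
    then show ?thesis
      unfolding split if_not_P[OF False] .
  next
    case True
    define b where "b = \<sigma> (i, Suc j)"
    have cell: "(i, Suc j) \<in> diagram lam"
      using ik by (simp add: mem_diagram_iff)
    obtain p where p: "u p = b" "p \<in> {1..n}"
      using permutes_image[OF step.prems(2)] filling_range[OF cell] unfolding b_def
      by (metis imageE)
    have "p = i \<or> height j + 1 \<le> p"
    proof (rule ccontr)
      assume "\<not> ?thesis"
      then consider "p < i" | "i < p" "p \<le> height j"
        by linarith
      then show False
      proof cases
        case 1
        then have "(p, Suc j) \<in> diagram lam" "u p = \<sigma> (p, Suc j)"
          using p ik True by (auto simp: mem_diagram_iff)
        then show False
          using filling_same_column[OF _ cell] 1 p by (auto simp: b_def)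
      next
        case 2
        then have "(p, j) \<in> diagram lam" "u p = \<sigma> (p, j)"
          using p j step.prems by (auto simp: mem_diagram_iff)
        then show False
          using filling_next_column[OF cell] 2 p by (auto simp: b_def)
      qed
    qed
    have row: "fold_sum n lam (?row i) rest u =
       (if p = i then G' else if p < height j + 1 then 0
        else swap_factor (arm lam (i, Suc j - 1)) (height j + 1 - i) (u i) b
               (num_between u i (height j + 1) (u i) b) * G')"
    proof (rule fold_sum_row[where ?c0.0 = "height j + 1" and f = u])
      fix u' assume u': "u' permutes {1..n}" "\<forall>p<height j + 1. p \<noteq> i \<longrightarrow> u' p = u p"
      have "(\<forall>p\<in>{1..<Suc i}. u' p = \<sigma> (p, Suc j)) \<longleftrightarrow> u' i = b"
      proof
        assume "u' i = b"
        show "\<forall>p\<in>{1..<Suc i}. u' p = \<sigma> (p, Suc j)"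
        proof
          fix p assume "p \<in> {1..<Suc i}"
          then show "u' p = \<sigma> (p, Suc j)"
            using u'(2)[rule_format, of p] True \<open>u' i = b\<close> ik by (cases "p = i") (auto simp: b_def)
        qed
      qed (use ik in \<open>simp add: b_def\<close>)
      moreover have "\<forall>p\<in>{Suc i..height j}. u' p = u p"
        using u'(2) by auto
      ultimately show "rest u' = (if u' i = b then G' else 0)"
        using rest[OF u'(1)] by simp
    qed (use ik step.prems p in auto)
    have ui: "u i = \<sigma> (i, j)"
      using step.prems ik by auto
    have nb: "num_between u i (height j + 1) x y = num_between (\<lambda>p. \<sigma> (p, j)) i (height j + 1) x y" for x y
      unfolding num_between_def using step.prems by (intro arg_cong[of _ _ card]) auto
    have "fold_sum n lam (?row i) rest u = cell_weight (i, j) * G'"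
    proof (cases "p = i")
      case True
      then show ?thesis
        using row p ui by (simp add: cell_weight_def b_def)
    next
      case False
      then have "height j + 1 \<le> p"
        using \<open>p = i \<or> _\<close> by simp
      moreover have "u i \<noteq> b"
        using False p permutes_inj[OF step.prems(2)] by (auto dest: injD)
      ultimately show ?thesis
        using row False ui nb ik by (simp add: cell_weight_def b_def)
    qed
    moreover have "{i..height (Suc j)} = insert i {Suc i..height (Suc j)}"
      using ik by auto
    ultimately show ?thesis
      using True split by (simp add: G'_def)
  qed
qed

text \<open>The condition that a permutation passed on the way has the right column of \<open>\<sigma>\<close> in its first
  positions. It says something only where a factor of the chain begins or ends.\<close>

definition column_guard :: "nat \<Rightarrow> (nat \<Rightarrow> nat) \<Rightarrow> bool" where
  "column_guard s u \<longleftrightarrow> (\<forall>j\<in>{1..lam 1}. s = length (chain_prefix j) \<longrightarrow> (\<forall>i\<in>{1..height j}. u i = \<sigma> (i, j)))"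

lemma chain_prefix_length_less:
  assumes "1 \<le> j" "j < k" "k \<le> lam 1"
  shows "length (chain_prefix k) < length (chain_prefix j)"
  using assms(2,1,3)
proof (induction j k rule: less_Suc_induct)
  case (1 i)
  then show ?case
    using column_steps_nonempty[of i] by (simp add: chain_prefix_Suc)
next
  case (2 i j k)
  then show ?case by simp
qed

lemma column_guard_at:
  assumes "j \<in> {1..lam 1}"
  shows "column_guard (length (chain_prefix j)) u \<longleftrightarrow> (\<forall>i\<in>{1..height j}. u i = \<sigma> (i, j))"
proof -
  have "k = j" if "length (chain_prefix j) = length (chain_prefix k)" "k \<in> {1..lam 1}" for k
    using chain_prefix_length_less[of j k] chain_prefix_length_less[of k j] that assms
    by (cases j k rule: linorder_cases) auto
  then show ?thesis
    unfolding column_guard_def using assms by blast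
qed

lemma column_guard_inside:
  assumes "1 \<le> j" "j < lam 1" "length (chain_prefix (Suc j)) < s" "s < length (chain_prefix j)"
  shows "column_guard s u"
proof -
  have "s \<noteq> length (chain_prefix k)" if "k \<in> {1..lam 1}" for k
  proof (cases "k \<le> j")
    case True
    then show ?thesis
      using chain_prefix_length_less[of k j] assms that by (cases "k = j") auto
  next
    case False
    then show ?thesis
      using chain_prefix_length_less[of "Suc j" k] assms that by (cases "k = Suc j") auto
  qed
  then show ?thesis
    by (auto simp: column_guard_def)
qed

lemma guarded_sum_chain_prefix:
  assumes "1 \<le> j" "j \<le> lam 1" "v permutes {1..n}"
  shows "guarded_sum column_guard (rev (chain_prefix j)) v
    = (if \<forall>i\<in>{1..height j}. v i = \<sigma> (i, j)
       then \<Prod>j'\<in>{j..<lam 1}. \<Prod>i\<in>{1..height (Suc j')}. cell_weight (i, j') else 0)"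
  using assms(2,1,3)
proof (induction j arbitrary: v rule: inc_induct)
  case base
  then show ?case
    using column_guard_at[of "lam 1" v] by (simp add: chain_prefix_last del: One_nat_def)
next
  case (step j)
  let ?es = "column_steps (Suc j)" and ?es' = "rev (chain_prefix (Suc j))"
  let ?G = "\<Prod>j'\<in>{Suc j..<lam 1}. \<Prod>i\<in>{1..height (Suc j')}. cell_weight (i, j')"
  have app: "rev (chain_prefix j) = ?es @ ?es'"
    using step by (simp add: chain_prefix_Suc)
  have len: "length ?es + length ?es' = length (chain_prefix j)"
    using arg_cong[OF app, of length] by simp
  have "guarded_sum column_guard (?es @ ?es') v
      = of_bool (column_guard (length ?es + length ?es') v)
        * fold_sum n lam ?es (guarded_sum column_guard ?es') v"
    using step column_steps_nonempty[of j] len column_guard_inside[of j]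
    by (intro guarded_sum_append) auto
  also have "\<dots> = of_bool (\<forall>i\<in>{1..height j}. v i = \<sigma> (i, j))
      * fold_sum n lam ?es (guarded_sum column_guard ?es') v"
    unfolding len using step column_guard_at[of j v] by simp
  also have "\<dots> = (if \<forall>i\<in>{1..height j}. v i = \<sigma> (i, j)
      then (\<Prod>i\<in>{1..height (Suc j)}. cell_weight (i, j)) * ?G else 0)"
  proof (cases "\<forall>i\<in>{1..height j}. v i = \<sigma> (i, j)")
    case True
    have "fold_sum n lam ?es (guarded_sum column_guard ?es') v
        = (if \<forall>p\<in>{1..<1}. v p = \<sigma> (p, Suc j)
           then (\<Prod>i\<in>{1..height (Suc j)}. cell_weight (i, j)) * ?G else 0)"
      using step True unfolding column_steps_def diff_Suc_1
      by (intro fold_sum_column) auto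
    then show ?thesis
      using True by simp
  qed auto
  finally show ?case
    using step app by (simp add: prod.atLeast_Suc_lessThan)
qed

end

section \<open>The fibre as a set of backward paths\<close>

lemma fold_mult_empty: "fold_mult n lam w {} = w"
  by (simp add: fold_mult_def)

lemma sorted_list_of_set_insert_greatest:
  fixes P :: "nat set"
  assumes "finite P" "\<forall>x\<in>P. x < p"
  shows "sorted_list_of_set (insert p P) = sorted_list_of_set P @ [p]"
proof -
  have "sorted_list_of_set (set (sorted_list_of_set P @ [p])) = sorted_list_of_set P @ [p]"
    using assms by (intro sorted_list_of_set.idem_if_sorted_distinct)
      (auto simp: sorted_append less_imp_le)
  then show ?thesis
    using assms by simp
qed

lemma fold_mult_insert:
  assumes "finite P" "\<forall>x\<in>P. x < p"
  shows "fold_mult n lam w (insert p P) = fold_mult n lam w P \<circ> root_transposition (chain_root n lam p)"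
  by (simp add: fold_mult_def sorted_list_of_set_insert_greatest[OF assms])

lemma root_transposition_involution:
  "u \<circ> root_transposition r \<circ> root_transposition r = u"
  by (simp add: root_transposition_def comp_assoc split: prod.split)

context regular_shape
begin

lemma lam_1_pos: "1 \<le> lam 1"
  using lam_Suc_less[of 1] n_ge_2 by simp

lemma set_chain_prefix:
  assumes "1 \<le> j"
  shows "set (chain_prefix j) = {(j', i, c). j < j' \<and> j' \<le> lam 1 \<and> i \<in> {1..height j'} \<and> c \<in> {height (j' - 1) + 1..n}}"
proof -
  have "set (column_steps j')
      = {(j'', i, c). j'' = j' \<and> i \<in> {1..height j'} \<and> c \<in> {height (j' - 1) + 1..n}}"
    if "j < j'" for j'
    using set_column_steps[of "j' - 1"] that assms by simp
  then show ?thesis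
    by (auto simp: chain_prefix_def simp del: upt_Suc)
qed

lemma chain_root_bounds:
  assumes "p < length (Gamma_chain n lam)" "Gamma_chain n lam ! p = (j, i, c)"
  shows "2 \<le> j" "j \<le> lam 1" "1 \<le> i" "i \<le> height j" "height (j - 1) < c" "i < c" "c \<le> n"
proof -
  have "(j, i, c) \<in> set (chain_prefix 1)"
    using assms nth_mem[of p "Gamma_chain n lam"] by (simp only: chain_prefix_1)
  then have *: "2 \<le> j" "j \<le> lam 1" "1 \<le> i" "i \<le> height j" "height (j - 1) < c" "c \<le> n"
    by (auto simp: set_chain_prefix)
  moreover have "height j \<le> height (j - 1)"
    using * by (intro height_antimono) auto
  ultimately show "2 \<le> j" "j \<le> lam 1" "1 \<le> i" "i \<le> height j" "height (j - 1) < c" "i < c" "c \<le> n"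
    by simp_all
qed

lemma chain_split:
  assumes "1 \<le> j" "j \<le> lam 1"
  obtains es where "Gamma_chain n lam = chain_prefix j @ es" "\<forall>e\<in>set es. fst e \<le> j"
proof -
  have "\<exists>es. Gamma_chain n lam = chain_prefix j @ es \<and> (\<forall>e\<in>set es. fst e \<le> j)"
    using assms
  proof (induction j rule: nat_induct_at_least)
    case base
    then show ?case
      using chain_prefix_1 by (intro exI[of _ "[]"]) simp
  next
    case (Suc j)
    then obtain es where "Gamma_chain n lam = chain_prefix j @ es" "\<forall>e\<in>set es. fst e \<le> j"
      by auto
    then show ?case
      using Suc by (intro exI[of _ "rev (column_steps (Suc j)) @ es"])
        (auto simp: chain_prefix_Suc set_column_steps)
  qed
  then show ?thesis
    using that by blast
qed

lemma chain_factor_greater_iff: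
  assumes "1 \<le> j" "j \<le> lam 1" "p < length (Gamma_chain n lam)"
  shows "j < chain_factor n lam p \<longleftrightarrow> p < length (chain_prefix j)"
proof -
  obtain es where es: "Gamma_chain n lam = chain_prefix j @ es" "\<forall>e\<in>set es. fst e \<le> j"
    using chain_split assms by blast
  show ?thesis
  proof (cases "p < length (chain_prefix j)")
    case True
    then have "chain_prefix j ! p \<in> set (chain_prefix j)"
      by (rule nth_mem)
    then show ?thesis
      using True assms by (auto simp: chain_factor_def es nth_append set_chain_prefix)
  next
    case False
    then have "es ! (p - length (chain_prefix j)) \<in> set es"
      using assms(3) es by (intro nth_mem) auto
    then show ?thesis
      using False es(2) by (auto simp: chain_factor_def es(1) nth_append)
  qed
qed

lemma distinct_Gamma_chain: "distinct (Gamma_chain n lam)"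
proof -
  have product: "concat (map (\<lambda>i. map (\<lambda>c. (j, i, c)) cs) is) = map (Pair j) (List.product is cs)"
    for j :: nat and "is" cs :: "nat list"
    by (induction "is") auto
  have col: "distinct (column_steps j)" for j
    unfolding column_steps_def product
    by (simp add: distinct_map distinct_product inj_on_def del: upt_Suc)
  have "distinct (chain_prefix j)" if "1 \<le> j" "j \<le> lam 1" for j
    using that(2,1)
  proof (induction j rule: inc_induct)
    case base
    then show ?case by (simp add: chain_prefix_last del: One_nat_def)
  next
    case (step j)
    then show ?case
      using col[of "Suc j"] by (auto simp: chain_prefix_Suc set_chain_prefix set_column_steps)
  qed
  then show ?thesis
    using lam_1_pos unfolding chain_prefix_1[symmetric] by simp
qed

lemma root_transposition_permutes:
  assumes "p < length (Gamma_chain n lam)"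
  shows "root_transposition (chain_root n lam p) permutes {1..n}"
proof -
  obtain j i c where e: "Gamma_chain n lam ! p = (j, i, c)"
    by (cases "Gamma_chain n lam ! p")
  show ?thesis
    using chain_root_bounds[OF assms e]
    by (auto simp: chain_root_def e root_transposition_def intro!: permutes_swap_id)
qed

lemma fold_mult_permutes:
  assumes "w permutes {1..n}" "P \<subseteq> {..<length (Gamma_chain n lam)}"
  shows "fold_mult n lam w P permutes {1..n}"
proof -
  have "finite P"
    using assms finite_subset by blast
  then show ?thesis
    using assms(2)
  proof (induction P rule: finite_linorder_max_induct)
    case empty
    then show ?case
      using assms by (simp add: fold_mult_empty)
  next
    case (insert p P)
    then show ?case
      by (subst fold_mult_insert)
        (auto simp del: One_nat_def intro!: permutes_compose root_transposition_permutes)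
  qed
qed

text \<open>The reflection at \<open>p\<close> itself belongs to the permutation, in accordance with \<open>step_weight\<close>.\<close>

definition path_weight :: "(nat \<Rightarrow> nat) \<Rightarrow> nat set \<Rightarrow> qt_field" where
  "path_weight w J =
     (\<Prod>p\<in>J. step_weight n lam (Gamma_chain n lam ! p) (fold_mult n lam w {x \<in> J. x \<le> p}))"

text \<open>The folding pairs supported on the first \<open>p\<close> positions are sorted by the permutation \<open>v\<close> in which they
  end. This makes \<open>w\<close> redundant and allows the recursion that removes the last position.\<close>

definition guarded_paths ::
    "(nat \<Rightarrow> (nat \<Rightarrow> nat) \<Rightarrow> bool) \<Rightarrow> nat \<Rightarrow> (nat \<Rightarrow> nat) \<Rightarrow> ((nat \<Rightarrow> nat) \<times> nat set) set" where
  "guarded_paths C p v = {(w, J). w permutes {1..n} \<and> J \<subseteq> {..<p} \<and> fold_mult n lam w J = v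
     \<and> (\<forall>s\<le>p. C s (fold_mult n lam w {x \<in> J. x < s}))}"

lemma finite_guarded_paths: "finite (guarded_paths C p v)"
  by (rule finite_subset[of _ "{w. w permutes {1..n}} \<times> Pow {..<p}"])
     (auto simp: guarded_paths_def intro!: finite_permutations)

lemma guarded_paths_Suc:
  assumes "p < length (Gamma_chain n lam)" "C (Suc p) v"
  shows "guarded_paths C (Suc p) v = guarded_paths C p v \<union>
     (\<lambda>(w, J). (w, insert p J)) ` guarded_paths C p (v \<circ> root_transposition (chain_root n lam p))"
    (is "?L = ?A \<union> ?f ` ?B")
proof (intro equalityI subsetI)
  fix z assume "z \<in> ?L"
  then obtain w J where z: "z = (w, J)" and w: "w permutes {1..n}" and J: "J \<subseteq> {..<Suc p}"
    and v: "fold_mult n lam w J = v" and C: "\<forall>s\<le>Suc p. C s (fold_mult n lam w {x \<in> J. x < s})"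
    by (auto simp: guarded_paths_def)
  show "z \<in> ?A \<union> ?f ` ?B"
  proof (cases "p \<in> J")
    case False
    then have "J \<subseteq> {..<p}"
      using J by (auto simp: less_Suc_eq)
    then show ?thesis
      using w v C by (auto simp: z guarded_paths_def)
  next
    case True
    define J' where "J' = J - {p}"
    have J': "J = insert p J'" "J' \<subseteq> {..<p}"
      using True J by (auto simp: J'_def less_Suc_eq)
    have fin: "finite J'"
      using J'(2) finite_subset by blast
    have "v = fold_mult n lam w J' \<circ> root_transposition (chain_root n lam p)"
      using v fin J' fold_mult_insert[of J' p n lam w] by auto
    then have "fold_mult n lam w J' = v \<circ> root_transposition (chain_root n lam p)"
      by (simp only: root_transposition_involution)
    moreover have "{x \<in> J'. x < s} = {x \<in> J. x < s}" if "s \<le> p" for s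
      using that by (auto simp: J'_def)
    ultimately have "(w, J') \<in> ?B"
      using w C J'(2) by (auto simp: guarded_paths_def)
    then show ?thesis
      by (force simp: z J'(1))
  qed
next
  fix z assume z: "z \<in> ?A \<union> ?f ` ?B"
  then consider "z \<in> ?A" | "z \<in> ?f ` ?B"
    by blast
  then show "z \<in> ?L"
  proof cases
    case 1
    then obtain w J where z: "z = (w, J)" and w: "w permutes {1..n}" and J: "J \<subseteq> {..<p}"
      and v: "fold_mult n lam w J = v" and C: "\<forall>s\<le>p. C s (fold_mult n lam w {x \<in> J. x < s})"
      by (auto simp: guarded_paths_def)
    have "{x \<in> J. x < Suc p} = J"
      using J by auto
    then show ?thesis
      using w J v C assms(2) by (auto simp: z guarded_paths_def le_Suc_eq)
  next
    case 2
    then obtain w J where z: "z = (w, insert p J)" and w: "w permutes {1..n}" and J: "J \<subseteq> {..<p}"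
      and v: "fold_mult n lam w J = v \<circ> root_transposition (chain_root n lam p)"
      and C: "\<forall>s\<le>p. C s (fold_mult n lam w {x \<in> J. x < s})"
      by (auto simp: guarded_paths_def)
    have "fold_mult n lam w (insert p J) = v"
      using J v finite_subset[OF J]
      by (subst fold_mult_insert) (auto simp: root_transposition_involution)
    moreover have "{x \<in> insert p J. x < Suc p} = insert p J"
      using J by auto
    moreover have "{x \<in> insert p J. x < s} = {x \<in> J. x < s}" if "s \<le> p" for s
      using that by auto
    ultimately show ?thesis
      using w J C assms(2) by (auto simp: z guarded_paths_def le_Suc_eq)
  qed
qed

text \<open>By induction on \<open>p\<close>: the paths split according to whether they use the last position \<open>p\<close>, which
  matches the two summands in the recursion of \<open>guarded_sum\<close>.\<close>

lemma guarded_sum_eq_sum_paths: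
  assumes "p \<le> length (Gamma_chain n lam)" "v permutes {1..n}"
  shows "guarded_sum C (rev (take p (Gamma_chain n lam))) v
    = (\<Sum>(w, J)\<in>guarded_paths C p v. path_weight w J)"
  using assms
proof (induction p arbitrary: v)
  case 0
  have "guarded_paths C 0 v = (if C 0 v then {(v, {})} else {})"
    using 0 by (auto simp: guarded_paths_def fold_mult_empty)
  then show ?case
    by (simp add: path_weight_def)
next
  case (Suc p)
  define v' where "v' = v \<circ> root_transposition (chain_root n lam p)"
  have p: "p < length (Gamma_chain n lam)"
    using Suc.prems by simp
  have v': "v' permutes {1..n}"
    unfolding v'_def using root_transposition_permutes[OF p] Suc.prems
    by (intro permutes_compose)
  have v'_alt: "v \<circ> root_transposition (snd (Gamma_chain n lam ! p)) = v'"
    by (simp only: v'_def chain_root_def)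
  have rec: "guarded_sum C (rev (take (Suc p) (Gamma_chain n lam))) v
      = of_bool (C (Suc p) v) * ((\<Sum>(w, J)\<in>guarded_paths C p v. path_weight w J)
        + step_weight n lam (Gamma_chain n lam ! p) v * (\<Sum>(w, J)\<in>guarded_paths C p v'. path_weight w J))"
    using p Suc.IH[of v] Suc.IH[of v'] Suc.prems v'
    by (simp add: take_Suc_conv_app_nth v'_alt)
  show ?case
  proof (cases "C (Suc p) v")
    case False
    have "guarded_paths C (Suc p) v = {}"
    proof (rule ccontr)
      assume "guarded_paths C (Suc p) v \<noteq> {}"
      then obtain w J where J: "J \<subseteq> {..<Suc p}" "fold_mult n lam w J = v"
        and C: "C (Suc p) (fold_mult n lam w {x \<in> J. x < Suc p})"
        by (auto simp: guarded_paths_def)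
      have "{x \<in> J. x < Suc p} = J"
        using J by auto
      then show False
        using C J False by simp
    qed
    then show ?thesis
      using rec False by simp
  next
    case True
    let ?f = "\<lambda>(w, J). (w, insert p J)"
    have sub: "J \<subseteq> {..<p}" if "(w, J) \<in> guarded_paths C p u" for w J u
      using that by (auto simp: guarded_paths_def)
    have inj: "inj_on ?f (guarded_paths C p v')"
    proof (rule inj_onI)
      fix z z' assume z: "z \<in> guarded_paths C p v'" "z' \<in> guarded_paths C p v'" "?f z = ?f z'"
      then have "p \<notin> snd z" "p \<notin> snd z'"
        using sub[of "fst z" "snd z"] sub[of "fst z'" "snd z'"] by auto
      then show "z = z'"
        using z(3) insert_ident[of p "snd z" "snd z'"] by (simp add: case_prod_beta prod_eq_iff)
    qed
    have disj: "guarded_paths C p v \<inter> ?f ` guarded_paths C p v' = {}"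
      by (auto dest!: sub)
    have weight: "path_weight w (insert p J)
        = step_weight n lam (Gamma_chain n lam ! p) v * path_weight w J"
      if wJ: "(w, J) \<in> guarded_paths C p v'" for w J
    proof -
      have J: "J \<subseteq> {..<p}" "finite J" "p \<notin> J" "{x \<in> insert p J. x \<le> p} = insert p J"
        using sub[OF wJ] finite_subset[OF sub[OF wJ]] by auto
      have "{x \<in> insert p J. x \<le> q} = {x \<in> J. x \<le> q}" if "q \<in> J" for q
        using J that by auto
      moreover have "fold_mult n lam w (insert p J) = v"
        using J wJ
        by (subst fold_mult_insert) (auto simp: guarded_paths_def v'_def root_transposition_involution)
      ultimately show ?thesis
        using J by (simp add: path_weight_def)
    qed
    have "(\<Sum>(w, J)\<in>guarded_paths C (Suc p) v. path_weight w J)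
        = (\<Sum>(w, J)\<in>guarded_paths C p v. path_weight w J)
          + (\<Sum>(w, J)\<in>?f ` guarded_paths C p v'. path_weight w J)"
      unfolding guarded_paths_Suc[of p C v, OF p True, folded v'_def]
      using disj by (intro sum.union_disjoint) (auto simp: finite_guarded_paths)
    also have "(\<Sum>(w, J)\<in>?f ` guarded_paths C p v'. path_weight w J)
        = (\<Sum>(w, J)\<in>guarded_paths C p v'. path_weight w (insert p J))"
      by (subst sum.reindex[OF inj]) (simp add: case_prod_unfold)
    also have "\<dots> = (\<Sum>(w, J)\<in>guarded_paths C p v'.
        step_weight n lam (Gamma_chain n lam ! p) v * path_weight w J)"
      by (intro sum.cong) (auto simp: weight)
    finally show ?thesis
      using rec True by (simp add: sum_distrib_left case_prod_unfold)
  qed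
qed

lemma permutations_eqI:
  assumes "u permutes {1..n}" "v permutes {1..n}" "\<forall>i\<in>{1..n-1}. u i = v i"
  shows "u = v"
proof
  fix i
  have "u i = v i" if "i \<noteq> n" for i
  proof (cases "i \<in> {1..n}")
    case False
    then show ?thesis
      using assms by (simp add: permutes_not_in)
  qed (use assms(3) that in auto)
  moreover have "u n = v n"
  proof (rule ccontr)
    assume ne: "u n \<noteq> v n"
    obtain i where i: "v i = u n"
      using permutes_surj[OF assms(2)] by (metis surjD)
    then have "i \<noteq> n" using ne by auto
    then have "u i = u n"
      using calculation[of i] i by simp
    then show False
      using permutes_inj[OF assms(1)] \<open>i \<noteq> n\<close> by (auto dest: injD)
  qed
  ultimately show "u i = v i"
    by (cases "i = n") auto
qed

end

context regular_filling
begin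

text \<open>The first column has \<open>n - 1\<close> distinct entries, so it determines a permutation. This is the end point
  \<open>wT\<close> of all paths in the fibre.\<close>

lemma first_column_extends:
  obtains v where "v permutes {1..n}" "\<forall>i\<in>{1..height 1}. v i = \<sigma> (i, 1)"
proof -
  have cells: "(i, 1) \<in> diagram lam" if "i \<in> {1..n - 1}" for i
    using that by (simp add: mem_diagram_iff height_1[simplified])
  have inj: "inj_on (\<lambda>i. \<sigma> (i, 1)) {1..n - 1}"
    using filling_same_column cells by (meson inj_onI)
  have range: "(\<lambda>i. \<sigma> (i, 1)) ` {1..n - 1} \<subseteq> {1..n}"
    using filling_range cells by blast
  have "card ({1..n} - (\<lambda>i. \<sigma> (i, 1)) ` {1..n - 1}) = n - (n - 1)"
    using card_Diff_subset[OF _ range] card_image[OF inj] by simp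
  then have "card ({1..n} - (\<lambda>i. \<sigma> (i, 1)) ` {1..n - 1}) = 1"
    using n_ge_2 by simp
  then obtain z where z: "{1..n} - (\<lambda>i. \<sigma> (i, 1)) ` {1..n - 1} = {z}"
    by (auto simp: card_1_singleton_iff)
  define v where "v i = (if i \<in> {1..n - 1} then \<sigma> (i, 1) else if i = n then z else i)" for i
  have n: "{1..n} = insert n {1..n - 1}" "n \<notin> {1..n - 1}"
    using n_ge_2 by auto
  have v_eq: "v ` {1..n - 1} = (\<lambda>i. \<sigma> (i, 1)) ` {1..n - 1}" "v n = z"
    using n(2) by (auto simp: v_def)
  have "v ` {1..n} = {1..n}"
    using v_eq z range unfolding n(1) by auto
  moreover have "inj_on v {1..n}"
    using calculation by (intro eq_card_imp_inj_on) auto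
  moreover have "v i = i" if "i \<notin> {1..n}" for i
    using that n_ge_2 by (auto simp: v_def)
  ultimately have "v permutes {1..n}"
    by (intro bij_imp_permutes) (auto simp: bij_betw_def)
  moreover have "\<forall>i\<in>{1..height 1}. v i = \<sigma> (i, 1)"
    unfolding height_1 by (simp add: v_def)
  ultimately show ?thesis
    using that by blast
qed

lemma filling_map_eq_iff:
  assumes J: "J \<subseteq> {..<length (Gamma_chain n lam)}"
  shows "filling_map n lam (w, J) = \<sigma>
    \<longleftrightarrow> (\<forall>j\<in>{1..lam 1}. \<forall>i\<in>{1..height j}. fold_mult n lam w {x \<in> J. x < length (chain_prefix j)} i = \<sigma> (i, j))"
proof -
  have pos: "{p \<in> J. j < chain_factor n lam p} = {x \<in> J. x < length (chain_prefix j)}"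
    if "j \<in> {1..lam 1}" for j
    using J chain_factor_greater_iff[of j] that by auto
  have col: "(i, j) \<in> diagram lam \<longleftrightarrow> j \<in> {1..lam 1} \<and> i \<in> {1..height j}" for i j
  proof -
    have "j \<le> lam 1" if "1 \<le> j" "i \<in> {1..height j}"
      using that le_height_iff[of j 1] by simp
    then show ?thesis
      by (auto simp: mem_diagram_iff)
  qed
  have ext: "\<sigma> \<in> extensional (diagram lam)"
    using nonattacking by (auto simp: nonattacking_fillings_def PiE_def)
  have "filling_map n lam (w, J) = \<sigma> \<longleftrightarrow> (\<forall>(i, j)\<in>diagram lam.
      fold_mult n lam w {p \<in> J. j < chain_factor n lam p} i = \<sigma> (i, j))"
    using ext by (auto simp: filling_map_def fun_eq_iff restrict_def extensional_def)
  also have "\<dots> \<longleftrightarrow> (\<forall>j\<in>{1..lam 1}. \<forall>i\<in>{1..height j}.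
      fold_mult n lam w {p \<in> J. j < chain_factor n lam p} i = \<sigma> (i, j))"
    by (auto simp: col)
  also have "\<dots> \<longleftrightarrow> (\<forall>j\<in>{1..lam 1}. \<forall>i\<in>{1..height j}.
      fold_mult n lam w {x \<in> J. x < length (chain_prefix j)} i = \<sigma> (i, j))"
    using pos by simp
  finally show ?thesis .
qed

lemma chain_prefix_length_le:
  assumes "j \<in> {1..lam 1}"
  shows "length (chain_prefix j) \<le> length (Gamma_chain n lam)"
  using chain_prefix_length_less[of 1 j] chain_prefix_1 assms by (cases "j = 1") auto

lemma filling_fibre_eq_guarded_paths:
  assumes v: "v permutes {1..n}" "\<forall>i\<in>{1..height 1}. v i = \<sigma> (i, 1)"
  shows "filling_fibre n lam \<sigma> = guarded_paths column_guard (length (Gamma_chain n lam)) v"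
proof -
  let ?m = "length (Gamma_chain n lam)"
  have "(w, J) \<in> filling_fibre n lam \<sigma> \<longleftrightarrow> (w, J) \<in> guarded_paths column_guard ?m v" for w J
  proof (cases "w permutes {1..n} \<and> J \<subseteq> {..<?m}")
    case True
    define match where "match = (\<forall>j\<in>{1..lam 1}. \<forall>i\<in>{1..height j}.
      fold_mult n lam w {x \<in> J. x < length (chain_prefix j)} i = \<sigma> (i, j))"
    have "(\<forall>s\<le>?m. column_guard s (fold_mult n lam w {x \<in> J. x < s})) \<longleftrightarrow> match"
      unfolding column_guard_def match_def using chain_prefix_length_le by blast
    moreover have "fold_mult n lam w J = v" if match
    proof (rule permutations_eqI)
      have "{x \<in> J. x < length (chain_prefix 1)} = J"
        using True unfolding chain_prefix_1 by auto
      then have "\<forall>i\<in>{1..height 1}. fold_mult n lam w J i = \<sigma> (i, 1)"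
        using that[unfolded match_def, rule_format, of 1] lam_1_pos by simp
      then show "\<forall>i\<in>{1..n - 1}. fold_mult n lam w J i = v i"
        using v(2) unfolding height_1 by simp
    qed (use v True fold_mult_permutes in auto)
    ultimately show ?thesis
      using True filling_map_eq_iff[of J w]
      by (auto simp: filling_fibre_def guarded_paths_def folding_pairs_def match_def)
  qed (auto simp: filling_fibre_def guarded_paths_def folding_pairs_def)
  then show ?thesis
    by auto
qed

lemma sum_path_weight_fibre:
  "(\<Sum>(w, J)\<in>filling_fibre n lam \<sigma>. path_weight w J)
    = (\<Prod>j\<in>{1..<lam 1}. \<Prod>i\<in>{1..height (Suc j)}. cell_weight (i, j))"
proof -
  obtain v where v: "v permutes {1..n}" "\<forall>i\<in>{1..height 1}. v i = \<sigma> (i, 1)"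
    by (rule first_column_extends)
  have "(\<Sum>(w, J)\<in>filling_fibre n lam \<sigma>. path_weight w J)
      = guarded_sum column_guard (rev (chain_prefix 1)) v"
    using guarded_sum_eq_sum_paths[of "length (Gamma_chain n lam)" v column_guard] v
    unfolding filling_fibre_eq_guarded_paths[OF v] chain_prefix_1 by simp
  also have "\<dots> = (\<Prod>j\<in>{1..<lam 1}. \<Prod>i\<in>{1..height (Suc j)}. cell_weight (i, j))"
    using guarded_sum_chain_prefix[OF _ lam_1_pos v(1)] v(2) by simp
  finally show ?thesis .
qed

end

section \<open>The statistics of the filling\<close>

lemma power_int_sum:
  fixes x :: "'a :: field"
  assumes "x \<noteq> 0"
  shows "x powi (\<Sum>u\<in>A. f u) = (\<Prod>u\<in>A. x powi f u)"
  by (induction A rule: infinite_finite_induct) (auto simp: power_int_add assms)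

context regular_filling
begin

text \<open>A triple \<open>(k, i, j)\<close> stands for the cell \<open>(k, j)\<close> together with a higher row \<open>i\<close>. By strictness of
  \<open>\<lambda>\<close>, both \<open>(i, j)\<close> and \<open>(i, j + 1)\<close> are then cells, and \<open>(k, j)\<close> attacks both.\<close>

definition triples :: "(nat \<times> nat \<times> nat) set" where
  "triples = (SIGMA k : {k. 1 \<le> k \<and> 0 < lam k}. {1..<k} \<times> {1..lam k})"

lemma finite_rows: "finite {k. 1 \<le> k \<and> 0 < lam k}"
  using finite_column[of 1] by (simp add: Suc_le_eq)

lemma finite_triples: "finite triples"
  unfolding triples_def using finite_rows by (intro finite_SigmaI) auto

lemma card_triples: "card triples = n_stat lam"
  unfolding triples_def n_stat_def using finite_rows by (subst card_SigmaI) auto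

lemma mem_triples_iff: "(k, i, j) \<in> triples \<longleftrightarrow> 1 \<le> i \<and> i < k \<and> (k, j) \<in> diagram lam"
  by (auto simp: triples_def diagram_def)

lemma tripleD:
  assumes "(k, i, j) \<in> triples"
  shows "1 \<le> i" "i < k" "(k, j) \<in> diagram lam" "(i, j) \<in> diagram lam" "(i, Suc j) \<in> diagram lam"
    "\<sigma> (k, j) \<noteq> \<sigma> (i, j)" "\<sigma> (k, j) \<noteq> \<sigma> (i, Suc j)"
proof -
  show *: "1 \<le> i" "i < k" "(k, j) \<in> diagram lam"
    using assms by (auto simp: mem_triples_iff)
  show **: "(i, j) \<in> diagram lam" "(i, Suc j) \<in> diagram lam"
    using * diagram_above by blast+
  show "\<sigma> (k, j) \<noteq> \<sigma> (i, j)"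
    using filling_same_column[of k j i] * ** by simp
  show "\<sigma> (k, j) \<noteq> \<sigma> (i, Suc j)"
    using filling_next_column[of i j k] * ** by auto
qed

definition inner_cells :: "(nat \<times> nat) set" where
  "inner_cells = {(i, j). (i, j) \<in> diagram lam \<and> (i, Suc j) \<in> diagram lam}"

lemma inner_cells_eq:
  "inner_cells = (\<lambda>(j, i). (i, j)) ` (SIGMA j : {1..<lam 1}. {1..height (Suc j)})"
proof (intro equalityI subsetI)
  fix u assume "u \<in> inner_cells"
  then obtain i j where u: "u = (i, j)" "(i, j) \<in> diagram lam" "(i, Suc j) \<in> diagram lam"
    by (auto simp: inner_cells_def)
  then have i: "1 \<le> j" "i \<in> {1..height (Suc j)}"
    by (auto simp: mem_diagram_iff)
  then have "Suc j \<le> lam 1"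
    using le_height_iff[of "Suc j" 1] by simp
  then show "u \<in> (\<lambda>(j, i). (i, j)) ` (SIGMA j : {1..<lam 1}. {1..height (Suc j)})"
    using u(1) i by force
next
  fix u assume "u \<in> (\<lambda>(j, i). (i, j)) ` (SIGMA j : {1..<lam 1}. {1..height (Suc j)})"
  then obtain i j where "u = (i, j)" "1 \<le> j" "i \<in> {1..height (Suc j)}"
    by auto
  then show "u \<in> inner_cells"
    using height_Suc_le[of j] by (auto simp: inner_cells_def mem_diagram_iff)
qed

lemma finite_inner_cells: "finite inner_cells"
  unfolding inner_cells_eq by auto

lemma Des_subset: "Des lam \<sigma> \<subseteq> Diff lam \<sigma>" and Diff_subset: "Diff lam \<sigma> \<subseteq> inner_cells"
  by (auto simp: Des_def Diff_def inner_cells_def)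

text \<open>The number of cells below \<open>(i, j)\<close> in its column whose entries lie between those of \<open>(i, j)\<close> and of
  \<open>(i, j + 1)\<close>.\<close>

definition below_between :: "nat \<times> nat \<Rightarrow> nat" where
  "below_between = (\<lambda>(i, j).
     num_between (\<lambda>p. \<sigma> (p, j)) i (height j + 1) (\<sigma> (i, j)) (\<sigma> (i, Suc j)))"

definition step_sign :: "nat \<times> nat \<Rightarrow> int" where
  "step_sign = (\<lambda>(i, j). if \<sigma> (i, j) < \<sigma> (i, Suc j) then 1 else - 1)"

text \<open>An inversion lies within one column or in two consecutive ones. In both cases it is a pair of cells
  of a unique triple.\<close>

lemma card_Inv:
  "int (card (Inv lam \<sigma>)) = (\<Sum>(k, i, j)\<in>triples.
     of_bool (\<sigma> (i, j) > \<sigma> (k, j)) + of_bool (\<sigma> (k, j) > \<sigma> (i, Suc j)))"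
proof -
  define A where "A = {z \<in> triples. case z of (k, i, j) \<Rightarrow> \<sigma> (i, j) > \<sigma> (k, j)}"
  define B where "B = {z \<in> triples. case z of (k, i, j) \<Rightarrow> \<sigma> (k, j) > \<sigma> (i, Suc j)}"
  let ?f = "\<lambda>(k, i, j). ((i, j), (k, j))" and ?g = "\<lambda>(k, i, j). ((k, j), (i, Suc j))"
  have fin: "finite A" "finite B"
    using finite_triples by (auto simp: A_def B_def)
  have "Inv lam \<sigma> = ?f ` A \<union> ?g ` B"
  proof (intro equalityI subsetI)
    fix z assume "z \<in> Inv lam \<sigma>"
    then obtain i j k l where z: "z = ((i, j), (k, l))" and in_diagram: "(i, j) \<in> diagram lam" "(k, l) \<in> diagram lam"
      and order: "attacks (i, j) (k, l)" "reads_before (i, j) (k, l)" and inv: "\<sigma> (i, j) > \<sigma> (k, l)"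
      by (auto simp: Inv_def)
    have pos: "1 \<le> i" "1 \<le> k"
      using in_diagram by (auto simp: diagram_def)
    consider "l = j" "i < k" | "l = Suc j" "k < i"
      using order by (auto simp: attacks_def reads_before_def)
    then show "z \<in> ?f ` A \<union> ?g ` B"
    proof cases
      case 1
      then have "(k, i, j) \<in> A"
        using in_diagram inv pos by (auto simp: A_def mem_triples_iff)
      then show ?thesis
        using z 1 by force
    next
      case 2
      then have "(i, k, j) \<in> B"
        using in_diagram inv pos by (auto simp: B_def mem_triples_iff)
      then show ?thesis
        using z 2 by force
    qed
  next
    fix z assume "z \<in> ?f ` A \<union> ?g ` B"
    then show "z \<in> Inv lam \<sigma>"
      by (auto simp: A_def B_def Inv_def attacks_def reads_before_def dest: tripleD)
  qed
  moreover have "?f ` A \<inter> ?g ` B = {}"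
    by auto
  moreover have "inj_on ?f A" "inj_on ?g B"
    by (auto simp: inj_on_def)
  ultimately have "card (Inv lam \<sigma>) = card A + card B"
    using fin by (simp add: card_Un_disjoint card_image)
  moreover have "int (card A) = (\<Sum>(k, i, j)\<in>triples. of_bool (\<sigma> (i, j) > \<sigma> (k, j)))"
    using finite_triples by (simp add: A_def case_prod_unfold Int_def)
  moreover have "int (card B) = (\<Sum>(k, i, j)\<in>triples. of_bool (\<sigma> (k, j) > \<sigma> (i, Suc j)))"
    using finite_triples by (simp add: B_def case_prod_unfold Int_def)
  ultimately show ?thesis
    by (simp add: sum.distrib case_prod_unfold)
qed

lemma sum_step_sign_below_between:
  "(\<Sum>u\<in>Diff lam \<sigma>. step_sign u * int (below_between u))
    = (\<Sum>(k, i, j)\<in>triples. step_sign (i, j) * of_bool (between (\<sigma> (i, j)) (\<sigma> (i, Suc j)) (\<sigma> (k, j))))"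
proof -
  let ?g = "\<lambda>i j k. step_sign (i, j) * of_bool (between (\<sigma> (i, j)) (\<sigma> (i, Suc j)) (\<sigma> (k, j)))"
  have "(\<Sum>u\<in>Diff lam \<sigma>. step_sign u * int (below_between u))
      = (\<Sum>u\<in>inner_cells. step_sign u * int (below_between u))"
  proof (rule sum.mono_neutral_left[OF finite_inner_cells Diff_subset], intro ballI)
    fix u assume "u \<in> inner_cells - Diff lam \<sigma>"
    then obtain i j where "u = (i, j)" "\<sigma> (i, j) = \<sigma> (i, Suc j)"
      by (auto simp: inner_cells_def Diff_def)
    then show "step_sign u * int (below_between u) = 0"
      by (simp add: below_between_def num_between_def between_def)
  qed
  also have "\<dots> = (\<Sum>u\<in>inner_cells. \<Sum>k\<in>{Suc (fst u)..height (snd u)}. ?g (fst u) (snd u) k)"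
  proof (intro sum.cong refl)
    fix u assume "u \<in> inner_cells"
    obtain i j where u: "u = (i, j)" by (cases u)
    have "{p. i < p \<and> p < height j + 1 \<and> between (\<sigma> (i, j)) (\<sigma> (i, Suc j)) (\<sigma> (p, j))}
        = {Suc i..height j} \<inter> {p. between (\<sigma> (i, j)) (\<sigma> (i, Suc j)) (\<sigma> (p, j))}"
      by auto
    then have "int (below_between u)
        = (\<Sum>k\<in>{Suc i..height j}. of_bool (between (\<sigma> (i, j)) (\<sigma> (i, Suc j)) (\<sigma> (k, j))))"
      by (simp add: u below_between_def num_between_def)
    then show "step_sign u * int (below_between u)
        = (\<Sum>k\<in>{Suc (fst u)..height (snd u)}. ?g (fst u) (snd u) k)"
      by (simp only: u fst_conv snd_conv sum_distrib_left)
  qed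
  also have "\<dots> = (\<Sum>(u, k)\<in>(SIGMA u : inner_cells. {Suc (fst u)..height (snd u)}). ?g (fst u) (snd u) k)"
    using finite_inner_cells by (intro sum.Sigma) auto
  also have "\<dots> = (\<Sum>(k, i, j)\<in>triples. ?g i j k)"
  proof (rule sum.reindex_bij_witness[of _ "\<lambda>(k, i, j). ((i, j), k)" "\<lambda>(u, k). (k, fst u, snd u)"])
    fix z assume "z \<in> (SIGMA u : inner_cells. {Suc (fst u)..height (snd u)})"
    then show "(\<lambda>(u, k). (k, fst u, snd u)) z \<in> triples"
      by (auto simp: inner_cells_def mem_triples_iff mem_diagram_iff)
  next
    fix z assume "z \<in> triples"
    then obtain k i j where "z = (k, i, j)" "(k, i, j) \<in> triples"
      by (cases z) auto
    then show "(\<lambda>(k, i, j). ((i, j), k)) z \<in> (SIGMA u : inner_cells. {Suc (fst u)..height (snd u)})"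
      using tripleD[of k i j] by (auto simp: inner_cells_def mem_diagram_iff)
  qed auto
  finally show ?thesis .
qed

text \<open>Each triple contributes 1 to the left-hand side. Let \<open>a\<close>, \<open>b\<close>, \<open>c\<close> be the entries of \<open>(i, j)\<close>,
  \<open>(i, j + 1)\<close>, \<open>(k, j)\<close>. At most one of \<open>a > c\<close> and \<open>c > b\<close> holds if \<open>a < b\<close>, and none of them exactly if
  \<open>c\<close> lies between. At least one of them holds if \<open>a \<ge> b\<close>, and both exactly if \<open>c\<close> lies between.\<close>

lemma inversion_identity:
  "int (card (Inv lam \<sigma>)) + (\<Sum>u\<in>Diff lam \<sigma>. step_sign u * int (below_between u)) = int (n_stat lam)"
proof -
  have "int (card (Inv lam \<sigma>)) + (\<Sum>u\<in>Diff lam \<sigma>. step_sign u * int (below_between u))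
      = (\<Sum>(k, i, j)\<in>triples. of_bool (\<sigma> (i, j) > \<sigma> (k, j)) + of_bool (\<sigma> (k, j) > \<sigma> (i, Suc j))
          + step_sign (i, j) * of_bool (between (\<sigma> (i, j)) (\<sigma> (i, Suc j)) (\<sigma> (k, j))))"
    unfolding card_Inv sum_step_sign_below_between by (simp add: sum.distrib case_prod_unfold)
  also have "\<dots> = (\<Sum>z\<in>triples. 1)"
  proof (intro sum.cong refl)
    fix z assume "z \<in> triples"
    then obtain k i j where z: "z = (k, i, j)" "(k, i, j) \<in> triples"
      by (cases z) auto
    have "of_bool (a > c) + of_bool (c > b) + (if a < b then 1 else - 1) * of_bool (between a b c) = (1 :: int)"
      if "c \<noteq> a" "c \<noteq> b" for a b c
      using that by (auto simp: between_def)
    from this[OF tripleD(6,7)[OF z(2)]]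
    show "(case z of (k, i, j) \<Rightarrow> of_bool (\<sigma> (i, j) > \<sigma> (k, j)) + of_bool (\<sigma> (k, j) > \<sigma> (i, Suc j))
        + step_sign (i, j) * of_bool (between (\<sigma> (i, j)) (\<sigma> (i, Suc j)) (\<sigma> (k, j)))) = 1"
      by (simp add: z(1) step_sign_def)
  qed
  finally show ?thesis
    by (simp add: card_triples)
qed

lemma cell_weight_Diff:
  assumes "u \<in> Diff lam \<sigma>"
  shows "cell_weight u = (1 - t_var) / (1 - q_var ^ arm lam u * t_var ^ (leg lam u + 1))
     * t_var powi (step_sign u * int (below_between u) + (if u \<in> Des lam \<sigma> then int (leg lam u) else 0))
     * q_var ^ (if u \<in> Des lam \<sigma> then arm lam u else 0)"
proof -
  obtain i j where u: "u = (i, j)" by (cases u)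
  have cell: "(i, j) \<in> diagram lam" and ne: "\<sigma> (i, j) \<noteq> \<sigma> (i, Suc j)"
    and Des: "u \<in> Des lam \<sigma> \<longleftrightarrow> \<not> \<sigma> (i, j) < \<sigma> (i, Suc j)"
    using assms by (auto simp: u Diff_def Des_def)
  have "height j + 1 - i = leg lam u + 1"
    using cell by (simp add: u leg_eq mem_diagram_iff Suc_diff_le)
  then have *: "cell_weight u = swap_factor (arm lam u) (leg lam u + 1) (\<sigma> (i, j)) (\<sigma> (i, Suc j)) (below_between u)"
    using ne by (simp add: u cell_weight_def below_between_def)
  have pw: "t_var powi (- int k - 1) * t_var ^ (l + 1) = t_var powi (int l - int k)" for k l
    using power_int_add[of t_var "- int k - 1" "int (l + 1)"] t_var_nonzero
    by (simp only: power_int_of_nat) (simp add: algebra_simps)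
  show ?thesis
  proof (cases "\<sigma> (i, j) < \<sigma> (i, Suc j)")
    case True
    then show ?thesis
      using * Des by (simp add: swap_factor_def u step_sign_def)
  next
    case False
    have "cell_weight u = (t_var powi (- int (below_between u) - 1) * t_var ^ (leg lam u + 1)) * q_var ^ arm lam u
        * ((1 - t_var) / (1 - q_var ^ arm lam u * t_var ^ (leg lam u + 1)))"
      unfolding * swap_factor_def using False by (simp only: if_False ac_simps)
    then show ?thesis
      unfolding pw using False Des by (simp add: u step_sign_def ac_simps)
  qed
qed

text \<open>For a descent, \<open>swap_factor\<close> provides an additional power of \<open>q\<close>, the arm, and one of \<open>t\<close>, the leg. The arms add up to
  \<open>maj\<close>, and the legs are those subtracted in \<open>inv\<close>.\<close>

lemma prod_cell_weight:
  "(\<Prod>j\<in>{1..<lam 1}. \<Prod>i\<in>{1..height (Suc j)}. cell_weight (i, j))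
    = t_var powi (int (n_stat lam) - inv_stat lam \<sigma>) * q_var ^ maj_stat lam \<sigma>
      * (\<Prod>u\<in>Diff lam \<sigma>. (1 - t_var) / (1 - q_var ^ arm lam u * t_var ^ (leg lam u + 1)))"
proof -
  have fin: "finite (Diff lam \<sigma>)"
    using finite_inner_cells Diff_subset finite_subset by blast
  have Des: "(\<Sum>u\<in>Diff lam \<sigma>. if u \<in> Des lam \<sigma> then f u else 0) = (\<Sum>u\<in>Des lam \<sigma>. f u)"
    for f :: "nat \<times> nat \<Rightarrow> 'b :: comm_monoid_add"
    using fin Des_subset by (simp add: sum.inter_restrict[symmetric] Int_absorb1)
  have "(\<Prod>j\<in>{1..<lam 1}. \<Prod>i\<in>{1..height (Suc j)}. cell_weight (i, j)) = (\<Prod>u\<in>inner_cells. cell_weight u)"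
    unfolding inner_cells_eq
    by (subst prod.Sigma, simp, simp, subst prod.reindex) (auto simp: inj_on_def case_prod_unfold)
  also have "\<dots> = (\<Prod>u\<in>Diff lam \<sigma>. cell_weight u)"
    by (rule prod.mono_neutral_right[OF finite_inner_cells Diff_subset])
       (auto simp: inner_cells_def Diff_def cell_weight_def)
  also have "\<dots> = (\<Prod>u\<in>Diff lam \<sigma>. (1 - t_var) / (1 - q_var ^ arm lam u * t_var ^ (leg lam u + 1)))
      * t_var powi (\<Sum>u\<in>Diff lam \<sigma>. step_sign u * int (below_between u) + (if u \<in> Des lam \<sigma> then int (leg lam u) else 0))
      * q_var ^ (\<Sum>u\<in>Diff lam \<sigma>. if u \<in> Des lam \<sigma> then arm lam u else 0)"
    by (simp only: power_int_sum[OF t_var_nonzero] power_sum prod.distrib[symmetric] cell_weight_Diff cong: prod.cong)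
  also have "(\<Sum>u\<in>Diff lam \<sigma>. step_sign u * int (below_between u) + (if u \<in> Des lam \<sigma> then int (leg lam u) else 0))
      = int (n_stat lam) - inv_stat lam \<sigma>"
    unfolding sum.distrib Des using inversion_identity by (simp add: inv_stat_def)
  also have "(\<Sum>u\<in>Diff lam \<sigma>. if u \<in> Des lam \<sigma> then arm lam u else 0) = maj_stat lam \<sigma>"
    unfolding Des maj_stat_def ..
  finally show ?thesis
    by (simp only: ac_simps)
qed

end

context regular_shape
begin

section \<open>The weight of a folding pair\<close>

lemma perm_length_transpose_odd:
  assumes "u permutes {1..n}" "1 \<le> i" "i < c" "c \<le> n"
  shows "odd (int (perm_length n (u \<circ> transpose i c)) - int (perm_length n u))"
proof -
  have inj: "inj u" "inj (u \<circ> transpose i c)"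
    using permutes_inj[OF assms(1)] by (auto simp: inj_compose)
  have "u i \<noteq> u c"
    using inj(1) assms by (auto dest: injD)
  then consider "u i < u c" | "(u \<circ> transpose i c) i < (u \<circ> transpose i c) c"
    by fastforce
  then show ?thesis
  proof cases
    case 1
    then show ?thesis
      using perm_length_transpose[OF assms(2-4) inj(1)] by simp
  next
    case 2
    have "perm_length n u = perm_length n (u \<circ> transpose i c) + 1
        + 2 * num_between (u \<circ> transpose i c) i c ((u \<circ> transpose i c) i) ((u \<circ> transpose i c) c)"
      using perm_length_transpose[OF assms(2-4) inj(2) 2] unfolding transpose_comp_transpose .
    then show ?thesis
      by simp
  qed
qed

lemma fold_mult_through:
  assumes "J \<subseteq> {..<length (Gamma_chain n lam)}" "p \<in> J"
  shows "fold_mult n lam w {x \<in> J. x < p}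
    = fold_mult n lam w {x \<in> J. x \<le> p} \<circ> root_transposition (chain_root n lam p)"
proof -
  have "{x \<in> J. x \<le> p} = insert p {x \<in> J. x < p}"
    using assms by auto
  moreover have "finite {x \<in> J. x < p}"
    by (rule finite_subset[of _ "{..<p}"]) auto
  ultimately have "fold_mult n lam w {x \<in> J. x \<le> p}
      = fold_mult n lam w {x \<in> J. x < p} \<circ> root_transposition (chain_root n lam p)"
    by (simp add: fold_mult_insert)
  then show ?thesis
    by (simp only: root_transposition_involution)
qed

lemma perm_length_fold_telescope:
  assumes "finite J"
  shows "(\<Sum>p\<in>J. int (perm_length n (fold_mult n lam w {x \<in> J. x < p}))
       - int (perm_length n (fold_mult n lam w {x \<in> J. x \<le> p})))
    = int (perm_length n w) - int (perm_length n (fold_mult n lam w J))"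
  using assms
proof (induction J rule: finite_linorder_max_induct)
  case empty
  then show ?case
    by (simp add: fold_mult_empty)
next
  case (insert b J)
  have "{x \<in> insert b J. x < p} = {x \<in> J. x < p}" "{x \<in> insert b J. x \<le> p} = {x \<in> J. x \<le> p}"
    if "p \<in> J" for p
    using insert.hyps that by auto
  moreover have "{x \<in> insert b J. x < b} = J" "{x \<in> insert b J. x \<le> b} = insert b J" "b \<notin> J"
    using insert.hyps by (auto simp: less_imp_le)
  ultimately show ?case
    using insert by simp
qed

definition root_monomial :: "nat \<times> nat \<times> nat \<Rightarrow> qt_field" where
  "root_monomial = (\<lambda>(j, i, k). q_var ^ arm lam (i, j - 1) * t_var ^ (k - i))"

text \<open>The lengths in the exponent telescope along the path, and each factor of the products over \<open>T\<^sup>+\<close> and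
  \<open>T\<^sup>-\<close> belongs to exactly one position, because the entries of the chain are distinct.\<close>

lemma folding_summand_eq_path_weight:
  assumes "(w, J) \<in> folding_pairs n lam"
  shows "t_var powi fold_exponent n lam w J * (1 - t_var) ^ card J
      * (\<Prod>(j, i, k) \<in> T_plus n lam w J. 1 / (1 - q_var ^ arm lam (i, j - 1) * t_var ^ (k - i)))
      * (\<Prod>(j, i, k) \<in> T_minus n lam w J. (q_var ^ arm lam (i, j - 1) * t_var ^ (k - i))
           / (1 - q_var ^ arm lam (i, j - 1) * t_var ^ (k - i)))
    = path_weight w J"
proof -
  let ?L = "Gamma_chain n lam"
  have w: "w permutes {1..n}" and J: "J \<subseteq> {..<length ?L}"
    using assms by (auto simp: folding_pairs_def)
  have fin: "finite J"
    using J finite_subset by blast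
  define before where "before p = fold_mult n lam w {x \<in> J. x < p}" for p
  define after where "after p = fold_mult n lam w {x \<in> J. x \<le> p}" for p
  define e where "e p = (int (perm_length n (before p)) - int (perm_length n (after p)) - 1) div 2" for p
  define pos where "pos p \<longleftrightarrow> perm_length n (after p) < perm_length n (before p)" for p
  have step: "step_weight n lam (?L ! p) (after p) = t_var powi e p * (1 - t_var)
        * ((if pos p then 1 else root_monomial (?L ! p)) / (1 - root_monomial (?L ! p)))
      \<and> 2 * e p = int (perm_length n (before p)) - int (perm_length n (after p)) - 1
      \<and> (positive_folding n lam w J p \<longleftrightarrow> pos p)" if p: "p \<in> J" for p
  proof -
    obtain j i c where r: "?L ! p = (j, i, c)"
      by (cases "?L ! p")
    have p': "p < length ?L"
      using p J by auto
    note bounds = chain_root_bounds[OF p' r]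
    have before: "before p = after p \<circ> transpose i c"
      using fold_mult_through[OF J p, of w]
      by (simp add: before_def after_def chain_root_def r root_transposition_def)
    have "after p permutes {1..n}"
      unfolding after_def using w J by (intro fold_mult_permutes) auto
    then have "odd (int (perm_length n (before p)) - int (perm_length n (after p)))"
      unfolding before using bounds by (intro perm_length_transpose_odd)
    then have "2 * e p = int (perm_length n (before p)) - int (perm_length n (after p)) - 1"
      by (simp add: e_def)
    moreover have "positive_folding n lam w J p \<longleftrightarrow> pos p"
      using bruhat_less_transpose_iff[of i c n "after p"] bounds
      unfolding positive_folding_def before_def[symmetric] after_def[symmetric] pos_def before by simp
    moreover have "step_weight n lam (?L ! p) (after p) = t_var powi e p * (1 - t_var)
        * ((if pos p then 1 else root_monomial (?L ! p)) / (1 - root_monomial (?L ! p)))"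
      by (simp add: r step_weight_def Let_def before[symmetric] e_def pos_def root_monomial_def)
    ultimately show ?thesis
      by blast
  qed
  have "2 * (\<Sum>p\<in>J. e p) = (\<Sum>p\<in>J. int (perm_length n (before p)) - int (perm_length n (after p)) - 1)"
    unfolding sum_distrib_left using step by (intro sum.cong) auto
  also have "\<dots> = int (perm_length n w) - int (perm_length n (fold_mult n lam w J)) - int (card J)"
    using perm_length_fold_telescope[OF fin, of w] by (simp add: before_def after_def sum_subtractf)
  finally have exponent: "fold_exponent n lam w J = (\<Sum>p\<in>J. e p)"
    by (simp add: fold_exponent_def)
  have inj: "inj_on ((!) ?L) A" if "A \<subseteq> J" for A
    using J that by (intro inj_on_nth distinct_Gamma_chain) auto
  have "T_plus n lam w J = (!) ?L ` {p \<in> J. pos p}" "T_minus n lam w J = (!) ?L ` {p \<in> J. \<not> pos p}"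
    using step by (auto simp: T_plus_def T_minus_def)
  then have plus: "(\<Prod>r \<in> T_plus n lam w J. 1 / (1 - root_monomial r))
        = (\<Prod>p\<in>{p \<in> J. pos p}. 1 / (1 - root_monomial (?L ! p)))"
    and minus: "(\<Prod>r \<in> T_minus n lam w J. root_monomial r / (1 - root_monomial r))
        = (\<Prod>p\<in>{p \<in> J. \<not> pos p}. root_monomial (?L ! p) / (1 - root_monomial (?L ! p)))"
    using inj[of "{p \<in> J. pos p}"] inj[of "{p \<in> J. \<not> pos p}"] by (simp_all add: prod.reindex)
  have "path_weight w J = (\<Prod>p\<in>J. t_var powi e p * (1 - t_var)
        * ((if pos p then 1 else root_monomial (?L ! p)) / (1 - root_monomial (?L ! p))))"
    unfolding path_weight_def after_def[symmetric] using step by (intro prod.cong) auto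
  also have "\<dots> = t_var powi fold_exponent n lam w J * (1 - t_var) ^ card J
      * (\<Prod>p\<in>J. (if pos p then 1 else root_monomial (?L ! p)) / (1 - root_monomial (?L ! p)))"
    by (simp only: prod.distrib exponent power_int_sum[OF t_var_nonzero] prod_constant)
  also have "(\<Prod>p\<in>J. (if pos p then 1 else root_monomial (?L ! p)) / (1 - root_monomial (?L ! p)))
      = (\<Prod>p\<in>J. if pos p then 1 / (1 - root_monomial (?L ! p))
            else root_monomial (?L ! p) / (1 - root_monomial (?L ! p)))"
    by (intro prod.cong) auto
  also have "\<dots> = (\<Prod>r \<in> T_plus n lam w J. 1 / (1 - root_monomial r))
      * (\<Prod>r \<in> T_minus n lam w J. root_monomial r / (1 - root_monomial r))"
    unfolding plus minus using fin by (simp add: prod.If_cases Int_def Collect_conj_eq[symmetric] conj_commute)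
  finally show ?thesis
    by (simp add: root_monomial_def case_prod_unfold ac_simps)
qed

end

section \<open>The content of the filling\<close>

lemma sorted_list_of_set_insert_least:
  fixes P :: "nat set"
  assumes "finite P" "\<forall>x\<in>P. p < x"
  shows "sorted_list_of_set (insert p P) = p # sorted_list_of_set P"
proof -
  have "sorted_list_of_set (set (p # sorted_list_of_set P)) = p # sorted_list_of_set P"
    using assms by (intro sorted_list_of_set.idem_if_sorted_distinct) (auto simp: less_imp_le)
  then show ?thesis
    using assms by simp
qed

context regular_shape
begin

lemma chain_factor_antimono:
  assumes "p \<le> p'" "p' < length (Gamma_chain n lam)"
  shows "chain_factor n lam p' \<le> chain_factor n lam p"
proof (rule ccontr)
  let ?j = "chain_factor n lam p"
  assume "\<not> ?thesis"
  then have less: "?j < chain_factor n lam p'"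
    by simp
  obtain j i c where "Gamma_chain n lam ! p = (j, i, c)"
    by (cases "Gamma_chain n lam ! p")
  then have "1 \<le> ?j" "?j \<le> lam 1"
    using chain_root_bounds(1,2)[of p j i c] assms by (auto simp: chain_factor_def)
  then have "p' < length (chain_prefix ?j)" "\<not> p < length (chain_prefix ?j)"
    using chain_factor_greater_iff[of ?j p'] chain_factor_greater_iff[of ?j p] less assms by simp_all
  then show False
    using assms(1) by simp
qed

text \<open>The root \<open>(i, c)\<close> occurs in the factors \<open>\<Gamma>\<^bsub>j'\<^esub>\<close> with \<open>i \<le> \<lambda>'\<^bsub>j'\<^esub>\<close> and \<open>\<lambda>'\<^bsub>j'-1\<^esub> < c\<close>. The former says
  \<open>j' \<le> \<lambda>\<^sub>i\<close>, and the latter passes from \<open>j\<close> to all larger \<open>j'\<close>. The occurrences up to the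
  one in \<open>\<Gamma>\<^sub>j\<close> are therefore those with \<open>j \<le> j' \<le> \<lambda>\<^sub>i\<close>.\<close>

lemma chain_level_eq:
  assumes p: "p < length (Gamma_chain n lam)" and r: "Gamma_chain n lam ! p = (j, i, c)"
  shows "chain_level n lam p = lam i - (j - 1)"
proof -
  let ?L = "Gamma_chain n lam" and ?A = "{p'. p' \<le> p \<and> chain_root n lam p' = chain_root n lam p}"
  note bounds = chain_root_bounds[OF p r]
  have set_L: "set ?L = {(j', i, c). 1 < j' \<and> j' \<le> lam 1 \<and> i \<in> {1..height j'} \<and> c \<in> {height (j' - 1) + 1..n}}"
    using set_chain_prefix[of 1] by (simp only: chain_prefix_1)
  have "bij_betw (chain_factor n lam) ?A {j..lam i}"
  proof (rule bij_betwI')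
    fix p1 p2 assume "p1 \<in> ?A" "p2 \<in> ?A"
    then have "p1 < length ?L" "p2 < length ?L" "snd (?L ! p1) = snd (?L ! p2)"
      using p by (auto simp: chain_root_def)
    then show "chain_factor n lam p1 = chain_factor n lam p2 \<longleftrightarrow> p1 = p2"
      using distinct_Gamma_chain by (auto simp: chain_factor_def prod_eq_iff nth_eq_iff_index_eq[symmetric])
  next
    fix p1 assume p1: "p1 \<in> ?A"
    then have p1': "p1 < length ?L" and r1: "?L ! p1 = (chain_factor n lam p1, i, c)"
      using p r by (auto simp: chain_root_def chain_factor_def prod_eq_iff)
    have "j \<le> chain_factor n lam p1"
      using chain_factor_antimono[of p1 p] p p1 r by (simp add: chain_factor_def)
    moreover have "chain_factor n lam p1 \<le> lam i"
      using chain_root_bounds[OF p1' r1] le_height_iff by simp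
    ultimately show "chain_factor n lam p1 \<in> {j..lam i}"
      by simp
  next
    fix j' assume j': "j' \<in> {j..lam i}"
    have "i \<le> height j'"
      using le_height_iff[of j' i] j' bounds by simp
    moreover have "j' \<le> lam 1"
      using calculation le_height_iff[of j' 1] j' bounds by simp
    moreover have "height (j' - 1) \<le> height (j - 1)"
      using j' bounds by (intro height_antimono) auto
    ultimately have "(j', i, c) \<in> set ?L"
      unfolding set_L using j' bounds by auto
    then obtain p1 where p1: "p1 < length ?L" "?L ! p1 = (j', i, c)"
      by (auto simp: in_set_conv_nth)
    have "p1 \<le> p"
    proof (cases "j' = j")
      case True
      then show ?thesis
        using nth_eq_iff_index_eq[OF distinct_Gamma_chain p1(1) p] p1 r by simp
    next
      case False
      then have "chain_factor n lam p < chain_factor n lam p1"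
        using j' r p1 by (simp add: chain_factor_def)
      then show ?thesis
        using chain_factor_antimono[of p p1] p1 by (cases "p1 \<le> p") auto
    qed
    then have "p1 \<in> ?A"
      using p1 r by (simp add: chain_root_def)
    moreover have "j' = chain_factor n lam p1"
      using p1 by (simp add: chain_factor_def)
    ultimately show "\<exists>x\<in>?A. j' = chain_factor n lam x"
      by blast
  qed
  then have "card ?A = card {j..lam i}"
    by (rule bij_betw_same_card)
  then show ?thesis
    using bounds by (simp add: chain_level_def)
qed

text \<open>The affine reflections are applied from the right end of the chain, so this is the weight reached once
  the positions from \<open>p\<close> on have been used.\<close>

definition partial_weight :: "nat set \<Rightarrow> nat \<Rightarrow> nat \<Rightarrow> int" where
  "partial_weight J p =
     foldr (\<lambda>p. affine_reflection (chain_root n lam p) (int (chain_level n lam p)))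
       (sorted_list_of_set {x \<in> J. p \<le> x}) (\<lambda>i. int (lam i))"

lemma partial_weight_step:
  assumes "finite J"
  shows "partial_weight J p = (if p \<in> J
    then affine_reflection (chain_root n lam p) (int (chain_level n lam p)) (partial_weight J (Suc p))
    else partial_weight J (Suc p))"
proof (cases "p \<in> J")
  case True
  then have "{x \<in> J. p \<le> x} = insert p {x \<in> J. Suc p \<le> x}"
    by auto
  moreover have "sorted_list_of_set (insert p {x \<in> J. Suc p \<le> x}) = p # sorted_list_of_set {x \<in> J. Suc p \<le> x}"
    using assms by (intro sorted_list_of_set_insert_least) auto
  ultimately show ?thesis
    using True by (simp add: partial_weight_def)
next
  case False
  then have "{x \<in> J. p \<le> x} = {x \<in> J. Suc p \<le> x}"
    by (auto simp: Suc_le_eq le_less)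
  then show ?thesis
    using False by (simp add: partial_weight_def)
qed

lemma finite_diagram: "finite (diagram lam)"
proof (rule finite_subset)
  show "diagram lam \<subseteq> (SIGMA i : {..<n}. {1..lam i})"
  proof
    fix u assume "u \<in> diagram lam"
    then obtain i j where "u = (i, j)" "1 \<le> j" "j \<le> lam i"
      by (auto simp: diagram_def)
    then show "u \<in> (SIGMA i : {..<n}. {1..lam i})"
      using lam_eq_0[of i] by (cases "n \<le> i") auto
  qed
qed auto

end

context regular_filling
begin

definition content_before :: "nat \<Rightarrow> nat \<Rightarrow> int" where
  "content_before j y = int (card {u \<in> diagram lam. snd u < j \<and> \<sigma> u = y})"

lemma content_before_Suc:
  assumes "1 \<le> j"
  shows "content_before (Suc j) y = content_before j y + int (card {i \<in> {1..height j}. \<sigma> (i, j) = y})"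
proof -
  have "{u \<in> diagram lam. snd u < Suc j \<and> \<sigma> u = y}
      = {u \<in> diagram lam. snd u < j \<and> \<sigma> u = y} \<union> (\<lambda>i. (i, j)) ` {i \<in> {1..height j}. \<sigma> (i, j) = y}"
    using assms by (auto simp: mem_diagram_iff less_Suc_eq)
  moreover have "card ((\<lambda>i. (i, j)) ` {i \<in> {1..height j}. \<sigma> (i, j) = y}) = card {i \<in> {1..height j}. \<sigma> (i, j) = y}"
    by (intro card_image) (auto simp: inj_on_def)
  moreover have "{u \<in> diagram lam. snd u < j \<and> \<sigma> u = y} \<inter> (\<lambda>i. (i, j)) ` {i \<in> {1..height j}. \<sigma> (i, j) = y} = {}"
    by auto
  ultimately show ?thesis
    using finite_diagram by (simp add: content_before_def card_Un_disjoint)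
qed

text \<open>The invariant, while the factor \<open>\<Gamma>\<^sub>j\<close> is read backwards: coordinate \<open>x\<close> counts the cells in
  columns before \<open>j\<close> whose entry is the current one at position \<open>x\<close>, and the cells of row \<open>x\<close> from
  column \<open>j\<close> on.\<close>

definition weight_matches :: "(nat \<Rightarrow> nat) \<Rightarrow> nat set \<Rightarrow> nat \<Rightarrow> nat \<Rightarrow> bool" where
  "weight_matches w J j p \<longleftrightarrow> (\<forall>x\<in>{1..n}. partial_weight J p x
     = content_before j (fold_mult n lam w {y \<in> J. y < p} x) + int (lam x - (j - 1)))"

text \<open>The level is the number of cells of row \<open>i\<close> from column \<open>j\<close> on, and row \<open>c\<close> has none of these. Hence the
  affine reflection exchanges the first summands at \<open>i\<close> and \<open>c\<close> and leaves the second ones.\<close>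

lemma weight_matches_step:
  assumes J: "J \<subseteq> {..<length (Gamma_chain n lam)}"
    and p: "p < length (Gamma_chain n lam)" "chain_factor n lam p = j"
    and matches: "weight_matches w J j (Suc p)"
  shows "weight_matches w J j p"
proof (cases "p \<in> J")
  case False
  then have "{y \<in> J. y < Suc p} = {y \<in> J. y < p}"
    by (auto simp: less_Suc_eq)
  then show ?thesis
    using matches False partial_weight_step[of J p] finite_subset[OF J]
    by (simp add: weight_matches_def)
next
  case True
  obtain i c where r: "Gamma_chain n lam ! p = (j, i, c)"
    using p(2) by (cases "Gamma_chain n lam ! p") (auto simp: chain_factor_def)
  note bounds = chain_root_bounds[OF p(1) r]
  define u where "u = fold_mult n lam w {y \<in> J. y < Suc p}"
  define \<nu> where "\<nu> = partial_weight J (Suc p)"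
  have u_before: "fold_mult n lam w {y \<in> J. y < p} = u \<circ> transpose i c"
    using fold_mult_through[OF J True, of w]
    by (simp add: u_def less_Suc_eq_le chain_root_def r root_transposition_def)
  have \<nu>_before: "partial_weight J p = affine_reflection (i, c) (int (lam i - (j - 1))) \<nu>"
    using partial_weight_step[of J p] True finite_subset[OF J] chain_level_eq[OF p(1) r]
    by (simp add: \<nu>_def chain_root_def r)
  have \<nu>: "\<nu> x = content_before j (u x) + int (lam x - (j - 1))" if "x \<in> {1..n}" for x
    using matches that by (simp add: weight_matches_def u_def \<nu>_def)
  have "1 \<le> j - 1" "1 \<le> c"
    using bounds by simp_all
  then have "lam c < j - 1"
    using le_height_iff[of "j - 1" c] bounds by linarith
  show ?thesis
    unfolding weight_matches_def u_before \<nu>_before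
  proof
    fix x assume x: "x \<in> {1..n}"
    have "\<nu> i = content_before j (u i) + int (lam i - (j - 1))" "\<nu> c = content_before j (u c)"
      using \<nu>[of i] \<nu>[of c] bounds \<open>lam c < j - 1\<close> by auto
    then show "affine_reflection (i, c) (int (lam i - (j - 1))) \<nu> x
        = content_before j ((u \<circ> transpose i c) x) + int (lam x - (j - 1))"
      using \<nu>[OF x] bounds \<open>lam c < j - 1\<close>
      by (cases "x = i"; cases "x = c") (auto simp: affine_reflection_def)
  qed
qed

lemma weight_matches_column:
  assumes J: "J \<subseteq> {..<length (Gamma_chain n lam)}"
    and j: "1 \<le> j" "j < lam 1"
    and matches: "weight_matches w J (Suc j) (length (chain_prefix j))"
  shows "weight_matches w J (Suc j) (length (chain_prefix (Suc j)))"
proof -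
  have le: "length (chain_prefix (Suc j)) \<le> length (chain_prefix j)"
      "length (chain_prefix j) \<le> length (Gamma_chain n lam)"
    using chain_prefix_length_less[of j "Suc j"] chain_prefix_length_le[of j] j by auto
  show ?thesis
    using le(1)
  proof (induction rule: inc_induct)
    case base
    then show ?case by (rule matches)
  next
    case (step p)
    have p: "p < length (Gamma_chain n lam)"
      using step le by simp
    have "j < chain_factor n lam p" "\<not> Suc j < chain_factor n lam p"
      using chain_factor_greater_iff[OF _ _ p] j step by auto
    then show ?case
      using weight_matches_step[OF J p] step by simp
  qed
qed

text \<open>Between two factors the cell \<open>(x, j)\<close>, if it exists, moves from the second summand to the first,
  since its entry is the current one at position \<open>x\<close>.\<close>

lemma weight_matches_next_column:
  assumes w: "w permutes {1..n}" and J: "J \<subseteq> {..<length (Gamma_chain n lam)}"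
    and j: "1 \<le> j"
    and guard: "\<forall>i\<in>{1..height j}. fold_mult n lam w {y \<in> J. y < p} i = \<sigma> (i, j)"
    and matches: "weight_matches w J j p"
  shows "weight_matches w J (Suc j) p"
  unfolding weight_matches_def
proof
  fix x assume x: "x \<in> {1..n}"
  define u where "u = fold_mult n lam w {y \<in> J. y < p}"
  have "u permutes {1..n}"
    unfolding u_def using w J by (intro fold_mult_permutes) auto
  then have inj: "inj u"
    by (rule permutes_inj)
  have "{i \<in> {1..height j}. \<sigma> (i, j) = u x} = {i \<in> {1..height j}. u i = u x}"
    using guard by (auto simp: u_def)
  also have "\<dots> = (if x \<le> height j then {x} else {})"
    using inj x by (auto dest: injD)
  finally have "content_before (Suc j) (u x) = content_before j (u x) + of_bool (x \<le> height j)"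
    using content_before_Suc[OF j] by simp
  moreover have "x \<le> height j \<longleftrightarrow> j \<le> lam x"
    using le_height_iff j x by simp
  moreover have "partial_weight J p x = content_before j (u x) + int (lam x - (j - 1))"
    using matches x by (simp add: weight_matches_def u_def)
  ultimately show "partial_weight J p x = content_before (Suc j) (fold_mult n lam w {y \<in> J. y < p} x) + int (lam x - (Suc j - 1))"
    using j by (auto simp: u_def[symmetric])
qed

lemma fold_weight_eq_content:
  assumes fibre: "(w, J) \<in> filling_fibre n lam \<sigma>" and x: "x \<in> {1..n}"
  shows "fold_weight n lam J x = fill_content lam \<sigma> (w x)"
proof -
  have w: "w permutes {1..n}" and J: "J \<subseteq> {..<length (Gamma_chain n lam)}"
    and filling: "filling_map n lam (w, J) = \<sigma>"
    using fibre by (auto simp: filling_fibre_def folding_pairs_def)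
  have guard: "\<forall>i\<in>{1..height j}. fold_mult n lam w {y \<in> J. y < length (chain_prefix j)} i = \<sigma> (i, j)"
    if "1 \<le> j" "j \<le> lam 1" for j
    using filling that unfolding filling_map_eq_iff[OF J] by simp
  have "weight_matches w J j (length (chain_prefix j))" if "1 \<le> j" "j \<le> lam 1" for j
    using that
  proof (induction j rule: nat_induct_at_least)
    case base
    have "{x \<in> J. length (Gamma_chain n lam) \<le> x} = {}"
      using J by auto
    then have "partial_weight J (length (Gamma_chain n lam)) = (\<lambda>i. int (lam i))"
      unfolding partial_weight_def by (simp only:) simp
    moreover have "content_before 1 y = 0" for y
      by (auto simp: content_before_def mem_diagram_iff card_eq_0_iff)
    ultimately show ?case
      unfolding chain_prefix_1 weight_matches_def by simp
  next
    case (Suc j)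
    then show ?case
      using weight_matches_column[OF J] weight_matches_next_column[OF w J _ guard] by simp
  qed
  then have "weight_matches w J (Suc (lam 1)) (length (chain_prefix (lam 1)))"
    using weight_matches_next_column[OF w J _ guard] lam_1_pos by simp
  then have "partial_weight J 0 x = content_before (Suc (lam 1)) (w x) + int (lam x - lam 1)"
    using x unfolding chain_prefix_last weight_matches_def by (simp add: fold_mult_empty)
  moreover have "lam x - lam 1 = 0"
    using lam_less[of 1 x] x n_ge_2 by (cases "x = 1") auto
  moreover have "content_before (Suc (lam 1)) y = fill_content lam \<sigma> y" for y
  proof -
    have "snd u < Suc (lam 1)" if "u \<in> diagram lam" for u
      using that le_height_iff[of "snd u" 1] by (cases u) (auto simp: mem_diagram_iff)
    then show ?thesis
      unfolding content_before_def fill_content_def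
      by (intro arg_cong[of _ _ int] arg_cong[of _ _ card]) auto
  qed
  moreover have "fold_weight n lam J = partial_weight J 0"
    by (simp add: fold_weight_def partial_weight_def)
  ultimately show ?thesis
    by simp
qed

lemma weight_monomial_eq_content:
  assumes "(w, J) \<in> filling_fibre n lam \<sigma>"
  shows "x_monom n (perm_act w (fold_weight n lam J)) = x_monom n (fill_content lam \<sigma>)"
proof -
  have w: "w permutes {1..n}"
    using assms by (auto simp: filling_fibre_def folding_pairs_def)
  have "perm_act w (fold_weight n lam J) i = fill_content lam \<sigma> i" if "i \<in> {1..n}" for i
    using fold_weight_eq_content[OF assms, of "inv w i"] permutes_in_image[OF permutes_inv[OF w]] that
    by (simp add: perm_act_def permutes_inverses[OF w])
  then show ?thesis
    by (simp add: x_monom_def)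
qed

end

theorem theorem3p7:
  fixes n :: nat and lam :: "nat \<Rightarrow> nat" and \<sigma> :: "nat \<times> nat \<Rightarrow> nat"
  assumes "2 \<le> n" and "regular_partition n lam" and "\<sigma> \<in> nonattacking_fillings lam n"
  shows "filling_fibre n lam \<sigma> \<noteq> {}
    \<and> (\<forall>(w, J) \<in> filling_fibre n lam \<sigma>.
         x_monom n (perm_act w (fold_weight n lam J)) = x_monom n (fill_content lam \<sigma>))
    \<and> (\<Sum>(w, J) \<in> filling_fibre n lam \<sigma>.
           t_var powi fold_exponent n lam w J * (1 - t_var) ^ card J
           * (\<Prod>(j, i, k) \<in> T_plus n lam w J.
                1 / (1 - q_var ^ arm lam (i, j - 1) * t_var ^ (k - i)))
           * (\<Prod>(j, i, k) \<in> T_minus n lam w J.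
                (q_var ^ arm lam (i, j - 1) * t_var ^ (k - i))
                / (1 - q_var ^ arm lam (i, j - 1) * t_var ^ (k - i))))
       = t_var powi (int (n_stat lam) - inv_stat lam \<sigma>) * q_var ^ maj_stat lam \<sigma>
         * (\<Prod>u \<in> Diff lam \<sigma>.
              (1 - t_var) / (1 - q_var ^ arm lam u * t_var ^ (leg lam u + 1)))"
    (is "_ \<and> _ \<and> ?lhs = ?rhs")
proof -
  interpret regular_filling n lam \<sigma>
    by unfold_locales (fact assms)+
  have "?lhs = (\<Sum>(w, J) \<in> filling_fibre n lam \<sigma>. path_weight w J)"
  proof (intro sum.cong refl)
    fix z assume "z \<in> filling_fibre n lam \<sigma>"
    moreover obtain w J where z: "z = (w, J)"
      by (cases z)
    ultimately have "(w, J) \<in> folding_pairs n lam"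
      by (simp add: filling_fibre_def)
    then show "(case z of (w, J) \<Rightarrow> t_var powi fold_exponent n lam w J * (1 - t_var) ^ card J
           * (\<Prod>(j, i, k) \<in> T_plus n lam w J.
                1 / (1 - q_var ^ arm lam (i, j - 1) * t_var ^ (k - i)))
           * (\<Prod>(j, i, k) \<in> T_minus n lam w J.
                (q_var ^ arm lam (i, j - 1) * t_var ^ (k - i))
                / (1 - q_var ^ arm lam (i, j - 1) * t_var ^ (k - i))))
        = (case z of (w, J) \<Rightarrow> path_weight w J)"
      unfolding z prod.case by (rule folding_summand_eq_path_weight)
  qed
  then have sum: "?lhs = ?rhs"
    by (simp only: sum_path_weight_fibre prod_cell_weight)
  have "1 - t_var \<noteq> 0" "1 - q_var ^ a * t_var ^ (b + 1) \<noteq> 0" for a b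
    using qt_monomial_neq_1[of 1 0] qt_monomial_neq_1[of "b + 1" a] by simp_all
  moreover have "finite (Diff lam \<sigma>)"
    using finite_inner_cells Diff_subset finite_subset by blast
  ultimately have "?rhs \<noteq> 0"
    by (auto simp: t_var_nonzero q_var_nonzero prod_zero_iff simp del: add_Suc_right power_Suc)
  then have "filling_fibre n lam \<sigma> \<noteq> {}"
    using sum by auto
  then show ?thesis
    using sum weight_monomial_eq_content by auto
qed

end
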